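(* Suppose that the increment $X$ satisfies the irreducibility hypothesis: for every $x,y\in\mathbb{Z}$ there is $n\in\mathbb{N}$ with $\mathbf{P}_x(S_n=y)>0$. Suppose also that $\mathbb{E}(X^2)<\infty$ and $\mathbb{E}X=0$. Then, almost surely, $$\lim_{m\to\infty}\frac{r_m}{m}=\frac12 .$$
   Context: Notation: $\mathbb{N}=\{1,2,3,\dots\}$, $\mathbb{Z}_+=\{0\}\cup\mathbb{N}$. Let $X$ be a $\mathbb{Z}$-valued random variable and let $X^{(m)}_i$, $m,i\in\mathbb{N}$, be i.i.d. random variables on a probability space $(\Omega,\mathcal{F},\mathbb{P})$ with the same distribution as $X$. For $m\in\mathbb{N}$ let $S^{(m)}$ be the random walk $S^{(m)}_0:=0$, $S^{(m)}_n:=\sum_{i=1}^n X^{(m)}_i$ for $n\in\mathbb{N}$. For $x\in\mathbb{Z}$, $\mathbf{P}_x$ denotes a probability measure under which $S=(S_0,S_1,S_2,\dots)$ is a random walk with $S_0=x$ and i.i.d. increments distributed as $X$. Internal DLA (IDLA) cluster: $\mathfrak{C}_0:=\{0\}$ and, recursively for $m\in\mathbb{N}$, $\tau_m:=\inf\{n\in\mathbb{Z}_+: S^{(m)}_n\notin\mathfrak{C}_{m-1}\}$ and $\mathfrak{C}_m:=\mathfrak{C}_{m-1}\cup\{S^{(m)}_{\tau_m}\}$. (Under the irreducibility hypothesis, $\tau_m<\infty$ a.s. for all $m$.) For $m\in\mathbb{Z}_+$, $r_m:=\max\{r\in\mathbb{Z}_+:\mathbb{Z}\cap[-r,r]\subseteq\mathfrak{C}_m\}$.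 *)

theory Defs
  imports "HOL-Probability.Probability"
begin

definition walk :: "int \<Rightarrow> (nat \<Rightarrow> int) \<Rightarrow> nat \<Rightarrow> int" where
  "walk x \<xi> n = x + (\<Sum>i=1..n. \<xi> i)"

text \<open>The measure \<open>P\<^sub>x\<close> on path space: the law of the random walk started at \<open>x\<close> whose i.i.d.
  increments have distribution \<open>\<mu>\<close>. Under it, the walk \<open>S\<close> is the coordinate process.\<close>

definition walk_law :: "int measure \<Rightarrow> int \<Rightarrow> (nat \<Rightarrow> int) measure" where
  "walk_law \<mu> x =
     distr (\<Pi>\<^sub>M i\<in>{1..}. \<mu>) (\<Pi>\<^sub>M n\<in>UNIV. count_space UNIV) (walk x)"

lemma measurable_walk:
  assumes "sets \<mu> = UNIV"
  shows "walk x \<in> (\<Pi>\<^sub>M i\<in>{1..}. \<mu>) \<rightarrow>\<^sub>M (\<Pi>\<^sub>M n\<in>UNIV. count_space UNIV)"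
proof (rule measurable_PiM_single')
  fix n :: nat
  have coord: "(\<lambda>\<xi>. \<xi> i) \<in> (\<Pi>\<^sub>M i\<in>{1..}. \<mu>) \<rightarrow>\<^sub>M count_space UNIV" if "i \<ge> 1" for i :: nat
  proof -
    have "(\<lambda>\<xi>. \<xi> i) \<in> (\<Pi>\<^sub>M i\<in>{1..}. \<mu>) \<rightarrow>\<^sub>M \<mu>"
      using that by (intro measurable_component_singleton) auto
    also have "measurable (\<Pi>\<^sub>M i\<in>{1..}. \<mu>) \<mu> = measurable (\<Pi>\<^sub>M i\<in>{1..}. \<mu>) (count_space UNIV)"
      using assms by (intro measurable_cong_sets) auto
    finally show ?thesis .
  qed
  have add: "(\<lambda>\<xi>. f \<xi> + g \<xi>) \<in> K \<rightarrow>\<^sub>M count_space UNIV"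
    if f: "f \<in> K \<rightarrow>\<^sub>M count_space UNIV" and g: "g \<in> K \<rightarrow>\<^sub>M count_space UNIV"
    for f g :: "(nat \<Rightarrow> int) \<Rightarrow> int" and K
    by (rule measurable_compose_countable[OF measurable_compose[OF g] f]) simp
  have "(\<lambda>\<xi>. \<Sum>i=1..n. \<xi> i) \<in> (\<Pi>\<^sub>M i\<in>{1..}. \<mu>) \<rightarrow>\<^sub>M count_space UNIV"
    by (induction n) (auto intro!: add coord[simplified])
  then show "(\<lambda>\<xi>. walk x \<xi> n) \<in> (\<Pi>\<^sub>M i\<in>{1..}. \<mu>) \<rightarrow>\<^sub>M count_space UNIV"
    unfolding walk_def by (intro add) auto
qed auto

lemma prob_space_walk_law:
  assumes "prob_space \<mu>" "sets \<mu> = UNIV"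
  shows "prob_space (walk_law \<mu> x)"
  unfolding walk_law_def
  by (intro prob_space.prob_space_distr prob_space_PiM assms measurable_walk)

definition irreducible_increment :: "int measure \<Rightarrow> bool" where
  "irreducible_increment \<mu> \<longleftrightarrow>
     (\<forall>x y. \<exists>n\<ge>1. measure (walk_law \<mu> x) {S \<in> space (walk_law \<mu> x). S n = y} > 0)"

text \<open>The first exit time is \<open>\<infinity>\<close> if the path never leaves \<open>C\<close>.\<close>

definition exit_time :: "(nat \<Rightarrow> int) \<Rightarrow> int set \<Rightarrow> enat" where
  "exit_time S C = (INF n\<in>{n. S n \<notin> C}. enat n)"

text \<open>In \<open>cluster \<xi> m\<close>, the value \<open>\<xi> m i\<close> is the \<open>i\<close>-th increment of the \<open>m\<close>-th walk, \<open>m, i \<ge> 1\<close>.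
  A walk that never exits adds no point; under irreducibility this has probability 0.\<close>

primrec cluster :: "(nat \<Rightarrow> nat \<Rightarrow> int) \<Rightarrow> nat \<Rightarrow> int set" where
  "cluster \<xi> 0 = {0}"
| "cluster \<xi> (Suc m) =
     (case exit_time (walk 0 (\<xi> (Suc m))) (cluster \<xi> m) of
        enat n \<Rightarrow> insert (walk 0 (\<xi> (Suc m)) n) (cluster \<xi> m)
      | \<infinity> \<Rightarrow> cluster \<xi> m)"

definition inner_radius :: "(nat \<Rightarrow> nat \<Rightarrow> int) \<Rightarrow> nat \<Rightarrow> nat" where
  "inner_radius \<xi> m = Max {r. {- int r..int r} \<subseteq> cluster \<xi> m}"

lemma finite_cluster: "finite (cluster \<xi> m)"
  by (induction m) (auto split: enat.splits)

lemma zero_in_cluster: "0 \<in> cluster \<xi> m"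
  by (induction m) (auto split: enat.splits)

text \<open>The maximum in \<^const>\<open>inner_radius\<close> is over a finite nonempty set.\<close>

lemma finite_inner_radius_set: "finite {r. {- int r..int r} \<subseteq> cluster \<xi> m}"
proof (rule finite_subset)
  show "{r. {- int r..int r} \<subseteq> cluster \<xi> m} \<subseteq> nat ` cluster \<xi> m"
    by (force simp: image_iff)
qed (simp add: finite_cluster)

lemma inner_radius_set_nonempty: "{r. {- int r..int r} \<subseteq> cluster \<xi> m} \<noteq> {}"
  using zero_in_cluster[of \<xi> m] by (auto intro!: exI[of _ 0])

end

theory Submission
  imports Defs
begin

text \<open>
  The upper bound \<open>2 r\<^sub>m \<le> m\<close> is counting: a cluster has at most \<open>m + 1\<close> points. For the lower bound it
  suffices that a site \<open>z\<close> with \<open>\<bar>z\<bar> \<le> (1 - \<epsilon>) n\<close> is missing from the cluster of \<open>2 n\<close> walks with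
  probability at most \<open>exp (- \<kappa> n)\<close>: a union bound over the \<open>O(n)\<close> sites and the Borel-Cantelli lemma then
  show that almost surely all of them are eventually present.

  The estimate for one site rests on a test function \<open>f\<close> with values in a fixed bounded interval \<open>[0, B]\<close>
  that is subharmonic for the walk away from \<open>z\<close> (lemma \<open>barrier\<close>). As long as \<open>z\<close> is unoccupied, a
  walk cannot pass through \<open>z\<close> before it settles, so its settling place \<open>Y\<close> satisfies \<open>E f(Y) \<ge> f(0)\<close>
  whatever the current cluster is (\<open>expected_exit_value_ge\<close>). The walks are independent, so
  while \<open>z\<close> stays unoccupied the sum of \<open>f\<close> over the cluster of \<open>2 n\<close> walks cannot fall below \<open>2 n f(0)\<close>
  by a multiple of \<open>n\<close> except with exponentially small probability (\<open>exp_moment_grow\<close>). On the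
  other hand each site is filled at most once, so this sum is bounded deterministically by the sum of the
  \<open>2 n + 1\<close> largest values of \<open>f\<close>. For a suitable \<open>f\<close> that bound is smaller than \<open>2 n f(0)\<close> by a multiple
  of \<open>n\<close>, so that \<open>z\<close> must have been filled.

  The function \<open>f\<close> approximates the tent with peak at \<open>z\<close> and zeros at \<open>\<plusminus>n\<close>, whose area is about
  \<open>n - z\<^sup>2 / n\<close> while its value at \<open>0\<close> is \<open>1 - \<bar>z\<bar> / n\<close>; the gain is
  \<open>2 n (1 - \<bar>z\<bar> / n) - (n - z\<^sup>2 / n) = n (1 - \<bar>z\<bar> / n)\<^sup>2\<close>.
  The tent itself is not subharmonic off \<open>z\<close>, because jumps across \<open>z\<close> see its kink. It has to
  be built from a function \<open>g\<close> that is superharmonic off \<open>0\<close> and differs from \<open>\<bar>x\<bar>\<close> by at most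
  \<open>\<epsilon> \<bar>x\<bar> + O(1)\<close>, a substitute for the potential kernel of the walk
  (\<open>approximate_potential_kernel\<close>). The upward drift of \<open>\<bar>S\<bar>\<close> is summable over the starting
  point because \<open>E X\<^sup>2 < \<infinity>\<close>. Its tail is compensated by a small combination of the
  functions \<open>- \<bar>x - y\<bar>\<close>, each of which is superharmonic with a definite drop at \<open>y\<close>; the finitely many points near \<open>0\<close> are
  compensated by a bounded Foster function, which exists by irreducibility (\<open>foster_function\<close>).
\<close>

section \<open>Hitting probabilities and the minimum principle\<close>

locale increment_law = prob_space \<mu> for \<mu> :: "int measure" +
  assumes sets_law: "sets \<mu> = UNIV"
    and square_integrable: "integrable \<mu> (\<lambda>k. (real_of_int k)\<^sup>2)"
    and centred: "(\<integral>k. real_of_int k \<partial>\<mu>) = 0"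
    and irreducible: "irreducible_increment \<mu>"
begin

lemma space_law [simp]: "space \<mu> = UNIV"
  using sets_law sets_eq_imp_space_eq[of \<mu> "count_space UNIV"] by simp

lemma borel_measurable_law [measurable]: "f \<in> borel_measurable \<mu>"
  by (simp add: measurable_def sets_law)

definition step :: "(int \<Rightarrow> real) \<Rightarrow> int \<Rightarrow> real" where
  "step f x = (\<integral>k. f (x + k) \<partial>\<mu>)"

lemma integrable_abs: "integrable \<mu> (\<lambda>k. \<bar>real_of_int k\<bar>)"
proof (rule Bochner_Integration.integrable_bound[OF square_integrable])
  have "\<bar>real_of_int k\<bar> \<le> (real_of_int k)\<^sup>2" for k
  proof -
    have "\<bar>k\<bar> \<le> k\<^sup>2"
      by (metis abs_ge_zero abs_le_square_iff int_one_le_iff_zero_less mult_le_cancel_left1 not_le order_refl power2_abs power2_eq_square zero_less_abs_iff abs_0 zero_power2)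
    then show ?thesis by (metis of_int_abs of_int_le_iff of_int_power)
  qed
  then show "AE k in \<mu>. norm \<bar>real_of_int k\<bar> \<le> norm ((real_of_int k)\<^sup>2)" by simp
qed simp

lemma integrable_linear_growth:
  fixes f :: "int \<Rightarrow> real"
  assumes "\<And>k. \<bar>f k\<bar> \<le> a * \<bar>real_of_int k\<bar> + b"
  shows "integrable \<mu> f"
proof (rule Bochner_Integration.integrable_bound)
  show "integrable \<mu> (\<lambda>k. a * \<bar>real_of_int k\<bar> + b)"
    using integrable_abs by simp
  show "AE k in \<mu>. norm (f k) \<le> norm (a * \<bar>real_of_int k\<bar> + b)"
    using assms by (simp add: order_trans[OF _ abs_ge_self])
qed simp

lemma integrable_bounded:
  fixes f :: "int \<Rightarrow> real"
  assumes "\<And>k. \<bar>f k\<bar> \<le> b"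
  shows "integrable \<mu> f"
  by (rule integrable_linear_growth[of f 0 b]) (use assms in auto)

lemma step_mono_bounded:
  assumes "\<And>k. \<bar>f k\<bar> \<le> b" "\<And>k. \<bar>g k\<bar> \<le> c" "\<And>k. f k \<le> g k"
  shows "step f x \<le> step g x"
  unfolding step_def
  by (rule integral_mono) (auto intro: integrable_bounded[of _ b] integrable_bounded[of _ c] assms)

text \<open>
  A law on a countable set gives no mass to the union of its null atoms.
\<close>
lemma AE_charged: "AE k in \<mu>. 0 < measure \<mu> {k}"
proof -
  have "AE k in \<mu>. \<forall>j\<in>{j. measure \<mu> {j} = 0}. k \<noteq> j"
    by (subst AE_ball_countable)
      (auto intro!: AE_I[where N = "{_}"] simp: sets_law emeasure_eq_measure)
  then show ?thesis
    by eventually_elim (metis (mono_tags, lifting) measure_nonneg mem_Collect_eq less_eq_real_def)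
qed

text \<open>
  Irreducibility is a statement about the law of the path. It is used only in this combinatorial form: on an event of positive
  probability almost every path takes steps that are atoms of \<open>\<mu>\<close>, so one such path exists.
\<close>
lemma reachable:
  "\<exists>ks. (\<forall>k\<in>set ks. 0 < measure \<mu> {k}) \<and> x + sum_list ks = y"
proof -
  let ?P = "\<Pi>\<^sub>M i\<in>{1::nat..}. \<mu>"
  interpret P: prob_space ?P by (intro prob_space_PiM prob_space_axioms)
  obtain n where n: "n \<ge> 1"
      "measure (walk_law \<mu> x) {S \<in> space (walk_law \<mu> x). S n = y} > 0"
    using irreducible unfolding irreducible_increment_def by blast
  let ?E = "{\<xi> \<in> space ?P. walk x \<xi> n = y}"
  have meas: "{S \<in> space (walk_law \<mu> x). S n = y} \<in> sets (\<Pi>\<^sub>M n\<in>(UNIV::nat set). count_space (UNIV::int set))"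
  proof -
    have "{S \<in> space (\<Pi>\<^sub>M n\<in>(UNIV::nat set). count_space (UNIV::int set)). S n = y}
        \<in> sets (\<Pi>\<^sub>M n\<in>(UNIV::nat set). count_space (UNIV::int set))" by measurable
    then show ?thesis by (simp add: walk_law_def)
  qed
  have "measure (walk_law \<mu> x) {S \<in> space (walk_law \<mu> x). S n = y} =
      measure ?P (walk x -` {S \<in> space (walk_law \<mu> x). S n = y} \<inter> space ?P)"
    by (subst (1) walk_law_def) (rule measure_distr[OF measurable_walk[OF sets_law] meas])
  also have "walk x -` {S \<in> space (walk_law \<mu> x). S n = y} \<inter> space ?P = ?E"
    using measurable_space[OF measurable_walk[OF sets_law, of x]] by (auto simp: walk_law_def space_PiM)
  finally have pos: "measure ?P ?E > 0" using n by simp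
  have "AE \<xi> in ?P. \<forall>i\<in>{1..n}. 0 < measure \<mu> {\<xi> i}"
    by (intro AE_finite_allI AE_PiM_component prob_space_axioms AE_charged) auto
  moreover have "\<not> (AE \<xi> in ?P. walk x \<xi> n \<noteq> y)"
  proof
    assume "AE \<xi> in ?P. walk x \<xi> n \<noteq> y"
    then have "measure ?P ?E = 0"
      by (subst P.prob_eq_0) (use pos measure_notin_sets in \<open>force+\<close>)
    then show False using pos by simp
  qed
  ultimately obtain \<xi> where \<xi>: "walk x \<xi> n = y" "\<forall>i\<in>{1..n}. 0 < measure \<mu> {\<xi> i}"
    by (metis (mono_tags, lifting) eventually_mono)
  show ?thesis
  proof (intro exI[of _ "map \<xi> [1..<Suc n]"] conjI)
    show "x + sum_list (map \<xi> [1..<Suc n]) = y"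
      using \<xi>(1) by (simp add: walk_def interv_sum_list_conv_sum_set_nat atLeastLessThanSuc_atLeastAtMost del: upt_Suc)
  qed (use \<xi>(2) in auto)
qed

text \<open>
  The probability that the walk from \<open>x\<close> visits \<open>A\<close> within \<open>j\<close> steps, given by its first-step
  recursion.
\<close>
primrec hit :: "int set \<Rightarrow> nat \<Rightarrow> int \<Rightarrow> real" where
  "hit A 0 x = (if x \<in> A then 1 else 0)"
| "hit A (Suc j) x = (if x \<in> A then 1 else step (hit A j) x)"

lemma hit_bounds: "0 \<le> hit A j x \<and> hit A j x \<le> 1"
proof (induction j arbitrary: x)
  case (Suc j)
  have "integrable \<mu> (\<lambda>k. hit A j (x + k))"
    using Suc by (intro integrable_bounded[of _ 1]) (simp add: abs_le_iff)
  then have "0 \<le> step (hit A j) x" "step (hit A j) x \<le> 1"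
    unfolding step_def using Suc by (auto intro!: integral_nonneg_AE integral_le_const)
  then show ?case by simp
qed simp

lemma abs_hit_le: "\<bar>hit A j x\<bar> \<le> 1"
  using hit_bounds[of A j x] by simp

lemma hit_le_Suc: "hit A j x \<le> hit A (Suc j) x"
proof (induction j arbitrary: x)
  case 0
  show ?case using hit_bounds[of A "Suc 0" x] by (cases "x \<in> A") simp_all
next
  case (Suc j)
  then have "step (hit A j) x \<le> step (hit A (Suc j)) x"
    by (intro step_mono_bounded[of _ 1 _ 1] abs_hit_le)
  then show ?case by simp
qed

lemma hit_mono: "i \<le> j \<Longrightarrow> hit A i x \<le> hit A j x"
  by (rule lift_Suc_mono_le[of "\<lambda>j. hit A j x"]) (rule hit_le_Suc)

lemma hit_pos:
  assumes "\<forall>k\<in>set ks. 0 < measure \<mu> {k}" "x + sum_list ks \<in> A"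
  shows "0 < hit A (length ks) x"
  using assms
proof (induction ks arbitrary: x)
  case (Cons k ks)
  have IH: "0 < hit A (length ks) (x + k)"
    using Cons by (simp add: add.assoc)
  have "0 < measure \<mu> {k} * hit A (length ks) (x + k)"
    using IH Cons by simp
  also have "\<dots> = (\<integral>j. indicator {k} j * hit A (length ks) (x + k) \<partial>\<mu>)"
    by (simp add: sets_law)
  also have "\<dots> \<le> step (hit A (length ks)) x"
    unfolding step_def
  proof (rule integral_mono)
    show "integrable \<mu> (\<lambda>j. indicator {k} j * hit A (length ks) (x + k))"
      by (rule integrable_bounded[of _ 1]) (auto simp: abs_hit_le split: split_indicator)
    show "integrable \<mu> (\<lambda>j. hit A (length ks) (x + j))"
      by (intro integrable_bounded[of _ 1] abs_hit_le)
  qed (auto simp: hit_bounds split: split_indicator)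
  finally show ?case by simp
qed simp

text \<open>
  A bounded function that loses at least one unit per visit to \<open>F\<close> until \<open>A\<close> is reached. Off \<open>A\<close>
  one has \<open>step (hit A j) = hit A (j + 1)\<close>, so the drift of \<open>u = (\<Sum>j<N. hit A j)\<close> telescopes to
  \<open>hit A N\<close>. For large \<open>N\<close> the latter is bounded below on the finite set \<open>F\<close> by some \<open>p >
  0\<close>, and \<open>(N - u) / p\<close> is as required.
\<close>
lemma foster_function:
  assumes "finite F" "A \<noteq> {}"
  shows "\<exists>w b. (\<forall>x. 0 \<le> w x \<and> w x \<le> b) \<and>
    (\<forall>x. x \<notin> A \<longrightarrow> step w x \<le> w x - (if x \<in> F then 1 else 0))"
proof -
  have "\<exists>j. 0 < hit A j x" for x
  proof -
    obtain y where "y \<in> A" using assms by blast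
    then show ?thesis using reachable[of x y] hit_pos[of _ x A] by blast
  qed
  then obtain J where J: "\<And>x. 0 < hit A (J x) x" by metis
  define N where "N = Max (insert 0 (J ` F))"
  have pos: "0 < hit A N x" if "x \<in> F" for x
    using J[of x] hit_mono[of "J x" N A x] that assms by (auto simp: N_def intro: order.strict_trans2)
  define p where "p = Min (insert 1 (hit A N ` F))"
  have p: "0 < p" "\<And>x. x \<in> F \<Longrightarrow> p \<le> hit A N x"
    using pos assms by (auto simp: p_def)
  define u where "u x = (\<Sum>j<N. hit A j x)" for x
  have u: "0 \<le> u x" "u x \<le> N" for x
    using hit_bounds sum_bounded_above[of "{..<N}" "\<lambda>j. hit A j x" 1]
    by (auto simp: u_def intro!: sum_nonneg)
  have step_u: "step u x = u x + hit A N x" if "x \<notin> A" for x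
  proof -
    have "step u x = (\<Sum>j<N. step (hit A j) x)"
      unfolding step_def u_def by (intro Bochner_Integration.integral_sum integrable_bounded[of _ 1] abs_hit_le)
    also have "\<dots> = (\<Sum>j<N. hit A (Suc j) x)" using that by simp
    also have "\<dots> = u x + hit A N x"
      using that sum.lessThan_Suc_shift[of "\<lambda>j. hit A j x" N] by (simp add: u_def del: hit.simps(2))
    finally show ?thesis .
  qed
  define w where "w x = (N - u x) / p" for x
  have "step w x \<le> w x - (if x \<in> F then 1 else 0)" if "x \<notin> A" for x
  proof -
    have "step w x = (N - step u x) / p"
      unfolding step_def w_def
      by (subst Bochner_Integration.integral_divide_zero, subst Bochner_Integration.integral_diff)
        (auto intro!: integrable_bounded[of _ N] simp: u prob_space[simplified])
    also have "\<dots> = w x - hit A N x / p"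
      using step_u[OF that] by (simp add: w_def diff_divide_distrib add_divide_distrib)
    also have "\<dots> \<le> w x - (if x \<in> F then 1 else 0)"
      using p hit_bounds[of A N x] by (auto simp: field_simps)
    finally show ?thesis .
  qed
  moreover have "0 \<le> w x \<and> w x \<le> N / p" for x
    using u[of x] p(1) by (auto simp: w_def field_simps)
  ultimately show ?thesis by blast
qed

text \<open>
  If \<open>w\<close> is the Foster function of \<open>C\<close> with target \<open>- C\<close>, then \<open>D + e w\<close> is
  strictly superharmonic on \<open>C\<close> and hence has no negative minimum there; then let \<open>e\<close> tend to
  \<open>0\<close>. This contains the fact that the walk leaves every finite set: without it a constant negative \<open>D\<close> on
  \<open>C\<close> could not be excluded.
\<close>
lemma minimum_principle:
  fixes D :: "int \<Rightarrow> real"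
  assumes "finite C" and bdd: "\<And>x. \<bar>D x\<bar> \<le> b"
    and off: "\<And>x. x \<notin> C \<Longrightarrow> 0 \<le> D x"
    and sup: "\<And>x. x \<in> C \<Longrightarrow> step D x \<le> D x"
  shows "0 \<le> D x"
proof -
  have "infinite (- C)" using \<open>finite C\<close> by (simp add: Compl_eq_Diff_UNIV infinite_UNIV_int)
  then have "- C \<noteq> {}" by auto
  from foster_function[OF \<open>finite C\<close> this] obtain w c where
    w: "\<And>x. 0 \<le> w x" "\<And>x. w x \<le> c" and
    stepw: "\<And>x. x \<in> C \<Longrightarrow> step w x \<le> w x - 1"
    by (metis ComplD)
  have main: "0 \<le> D y + e * w y" if "e > 0" for e y
  proof (rule ccontr)
    assume neg: "\<not> 0 \<le> D y + e * w y"
    then have "y \<in> C" using off[of y] w(1)[of y] \<open>e > 0\<close> by fastforce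
    define v where "v x = D x + e * w x" for x
    obtain x0 where x0: "x0 \<in> C" "\<And>x. x \<in> C \<Longrightarrow> v x0 \<le> v x"
      using ex_min_if_finite[of "v ` C"] \<open>y \<in> C\<close> \<open>finite C\<close> by (force simp: not_less)
    have low: "v x0 \<le> v x" for x
    proof (cases "x \<in> C")
      case False
      have "v x0 \<le> v y" using x0 \<open>y \<in> C\<close> by simp
      also have "\<dots> \<le> 0" using neg by (simp add: v_def)
      also have "\<dots> \<le> v x" using off[OF False] w(1)[of x] \<open>e > 0\<close> by (simp add: v_def)
      finally show ?thesis .
    qed (use x0 in simp)
    have intD: "integrable \<mu> (\<lambda>k. D (x0 + k))" by (intro integrable_bounded[of _ b] bdd)
    have intw: "integrable \<mu> (\<lambda>k. w (x0 + k))"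
      using w by (intro integrable_bounded[of _ c]) auto
    have "v x0 = (\<integral>k. v x0 \<partial>\<mu>)" by (simp add: prob_space[simplified])
    also have "\<dots> \<le> (\<integral>k. v (x0 + k) \<partial>\<mu>)"
      using intD intw by (intro integral_mono low) (auto simp: v_def)
    also have "\<dots> = step D x0 + e * step w x0"
      using intD intw by (simp add: v_def step_def)
    also have "\<dots> \<le> D x0 + e * (w x0 - 1)"
      using sup[OF x0(1)] stepw[OF x0(1)] \<open>e > 0\<close> by (intro add_mono mult_left_mono) auto
    also have "\<dots> < v x0" using \<open>e > 0\<close> by (simp add: v_def algebra_simps)
    finally show False by simp
  qed
  have "- D x \<le> e" if "e > 0" for e
  proof -
    define e' where "e' = e / (1 + c)"
    have "0 \<le> c" using w order_trans by blast
    then have "e' > 0" using that by (simp add: e'_def)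
    have "e' * w x \<le> e' * (1 + c)" using w(2)[of x] \<open>e' > 0\<close> by (intro mult_left_mono) auto
    also have "\<dots> = e" using \<open>0 \<le> c\<close> by (simp add: e'_def)
    finally show ?thesis using main[OF \<open>e' > 0\<close>, of x] by simp
  qed
  then have "- D x \<le> 0" using field_le_epsilon[of "- D x" 0] by simp
  then show ?thesis by simp
qed

end

section \<open>An approximate potential kernel\<close>

context increment_law
begin

text \<open>
  The mean increase of \<open>\<bar>S\<bar>\<close> in one step from \<open>y\<close>. The walk being centred, only steps that cross
  the origin or start there contribute to it.
\<close>
definition drift :: "int \<Rightarrow> real" where
  "drift y = step (\<lambda>x. \<bar>real_of_int x\<bar>) y - \<bar>real_of_int y\<bar>"

lemma integrable_abs_shift: "integrable \<mu> (\<lambda>k. \<bar>real_of_int (x + k)\<bar>)"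
  by (rule integrable_linear_growth[of _ 1 "\<bar>real_of_int x\<bar>"]) simp

lemma drift_nonneg: "0 \<le> drift y"
proof -
  have "integrable \<mu> (\<lambda>k. real_of_int k)"
    using integrable_abs by (rule Bochner_Integration.integrable_bound) auto
  then have "real_of_int y = (\<integral>k. real_of_int (y + k) \<partial>\<mu>)"
    using centred by (simp add: prob_space[simplified])
  then have "\<bar>real_of_int y\<bar> \<le> (\<integral>k. \<bar>real_of_int (y + k)\<bar> \<partial>\<mu>)"
    using integral_abs_bound[of \<mu> "\<lambda>k. real_of_int (y + k)"] by simp
  then show ?thesis by (simp add: drift_def step_def)
qed

lemma drift_le: "drift y \<le> drift 0"
proof -
  have "step (\<lambda>x. \<bar>real_of_int x\<bar>) y \<le> (\<integral>k. \<bar>real_of_int y\<bar> + \<bar>real_of_int k\<bar> \<partial>\<mu>)"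
    unfolding step_def using integrable_abs
    by (intro integral_mono integrable_abs_shift) auto
  also have "\<dots> = \<bar>real_of_int y\<bar> + step (\<lambda>x. \<bar>real_of_int x\<bar>) 0"
    using integrable_abs by (simp add: step_def prob_space[simplified])
  finally show ?thesis by (simp add: drift_def)
qed

lemma drift_zero_pos: "0 < drift 0"
proof -
  obtain ks where ks: "\<forall>k\<in>set ks. 0 < measure \<mu> {k}" "0 + sum_list ks = 1"
    using reachable[of 0 1] by blast
  obtain k where k: "k \<in> set ks" "k \<noteq> 0"
  proof (rule ccontr)
    assume "\<not> thesis"
    then have "\<forall>k\<in>set ks. k = 0" using that by blast
    then have "sum_list ks = 0" by (induction ks) auto
    then show False using ks by simp
  qed
  have "0 < measure \<mu> {k} * \<bar>real_of_int k\<bar>" using k ks by simp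
  also have "\<dots> = (\<integral>j. indicator {k} j * \<bar>real_of_int k\<bar> \<partial>\<mu>)" by (simp add: sets_law)
  also have "\<dots> \<le> (\<integral>j. \<bar>real_of_int j\<bar> \<partial>\<mu>)"
    by (intro integral_mono integrable_abs integrable_bounded[of _ "\<bar>real_of_int k\<bar>"])
      (auto split: split_indicator)
  finally show ?thesis by (simp add: drift_def step_def)
qed

text \<open>
  Pairing \<open>y\<close> with \<open>- y\<close> turns each summand into \<open>max \<bar>y\<bar> \<bar>k\<bar> -
  \<bar>y\<bar>\<close>, which vanishes for \<open>\<bar>y\<bar> \<ge> \<bar>k\<bar>\<close>. So about \<open>2 \<bar>k\<bar>\<close>
  terms of size at most \<open>\<bar>k\<bar>\<close> remain.
\<close>
lemma sum_abs_increment_le: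
  "(\<Sum>y\<in>{-int L..int L}. \<bar>real_of_int (y + k)\<bar> - \<bar>real_of_int y\<bar>) \<le> 2 * (real_of_int k)\<^sup>2"
proof -
  let ?I = "{-int L..int L}"
  have "(\<Sum>y\<in>?I. \<bar>real_of_int (y + k)\<bar>) = (\<Sum>y\<in>?I. \<bar>real_of_int (y - k)\<bar>)"
    by (rule sum.reindex_bij_witness[of _ uminus uminus]) auto
  then have "2 * (\<Sum>y\<in>?I. \<bar>real_of_int (y + k)\<bar> - \<bar>real_of_int y\<bar>) =
      (\<Sum>y\<in>?I. \<bar>real_of_int (y + k)\<bar> + \<bar>real_of_int (y - k)\<bar> - 2 * \<bar>real_of_int y\<bar>)"
    by (simp add: sum.distrib sum_subtractf sum_distrib_left)
  also have "\<dots> \<le> (\<Sum>y\<in>?I. if y \<in> {- \<bar>k\<bar>..<\<bar>k\<bar>} then 2 * \<bar>real_of_int k\<bar> else 0)"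
    by (intro sum_mono) auto
  also have "\<dots> = (\<Sum>y\<in>?I \<inter> {- \<bar>k\<bar>..<\<bar>k\<bar>}. 2 * \<bar>real_of_int k\<bar>)"
    by (rule sum.inter_restrict[symmetric]) simp
  also have "\<dots> \<le> (\<Sum>y\<in>{- \<bar>k\<bar>..<\<bar>k\<bar>}. 2 * \<bar>real_of_int k\<bar>)"
    by (rule sum_mono2) auto
  also have "\<dots> = 4 * (real_of_int k)\<^sup>2"
    by (simp add: power2_eq_square)
  finally show ?thesis by simp
qed

text \<open>
  This is where the second moment of the increment enters.
\<close>
lemma sum_drift_le: "(\<Sum>y\<in>{-int L..int L}. drift y) \<le> 2 * (\<integral>k. (real_of_int k)\<^sup>2 \<partial>\<mu>)"
proof -
  let ?I = "{-int L..int L}"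
  have d: "drift y = (\<integral>k. \<bar>real_of_int (y + k)\<bar> - \<bar>real_of_int y\<bar> \<partial>\<mu>)" for y
    unfolding drift_def step_def
    by (subst Bochner_Integration.integral_diff) (use integrable_abs_shift[of y] in \<open>auto simp: prob_space[simplified]\<close>)
  have "(\<Sum>y\<in>?I. drift y) = (\<integral>k. (\<Sum>y\<in>?I. \<bar>real_of_int (y + k)\<bar> - \<bar>real_of_int y\<bar>) \<partial>\<mu>)"
    unfolding d using integrable_abs_shift
    by (intro Bochner_Integration.integral_sum[symmetric] Bochner_Integration.integrable_diff) auto
  also have "\<dots> \<le> (\<integral>k. 2 * (real_of_int k)\<^sup>2 \<partial>\<mu>)"
    using square_integrable integrable_abs_shift
    by (intro integral_mono sum_abs_increment_le Bochner_Integration.integrable_sum Bochner_Integration.integrable_diff) auto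
  finally show ?thesis using square_integrable by simp
qed

lemma drift_tail:
  assumes "0 < \<delta>"
  obtains K where "\<And>L. (\<Sum>y\<in>{y. int K < \<bar>y\<bar> \<and> \<bar>y\<bar> \<le> int L}. drift y) \<le> \<delta>"
proof -
  define a where "a L = (\<Sum>y\<in>{-int L..int L}. drift y)" for L
  have "incseq a"
    unfolding a_def by (intro incseq_SucI sum_mono2) (auto simp: drift_nonneg)
  moreover have "a L \<le> 2 * (\<integral>k. (real_of_int k)\<^sup>2 \<partial>\<mu>)" for L
    unfolding a_def by (rule sum_drift_le)
  ultimately obtain l where l: "a \<longlonglongrightarrow> l" "\<forall>L. a L \<le> l"
    using incseq_convergent by blast
  have "eventually (\<lambda>K. l - \<delta> < a K) sequentially"
    using l(1) assms by (intro order_tendstoD) auto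
  then obtain K where K: "l - \<delta> < a K" by (auto simp: eventually_sequentially)
  have "(\<Sum>y\<in>{y. int K < \<bar>y\<bar> \<and> \<bar>y\<bar> \<le> int L}. drift y) \<le> \<delta>" for L
  proof (cases "K \<le> L")
    case True
    have "{y. int K < \<bar>y\<bar> \<and> \<bar>y\<bar> \<le> int L} = {-int L..int L} - {-int K..int K}" by auto
    then have "(\<Sum>y\<in>{y. int K < \<bar>y\<bar> \<and> \<bar>y\<bar> \<le> int L}. drift y) = a L - a K"
      unfolding a_def using True by (simp add: sum_diff)
    then show ?thesis using K l(2)[rule_format, of L] by linarith
  next
    case False
    then have "{y. int K < \<bar>y\<bar> \<and> \<bar>y\<bar> \<le> int L} = {}" by auto
    then show ?thesis using assms by (simp only: sum.empty)
  qed
  then show thesis by (rule that)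
qed

text \<open>
  The true potential kernel is harmonic off \<open>0\<close> and asymptotic to a multiple of \<open>\<bar>x\<bar>\<close>. Starting
  from \<open>\<bar>x\<bar>\<close>, whose drift is \<open>drift \<ge> 0\<close>, two corrections make it superharmonic. At a site
  \<open>y\<close> with \<open>K < \<bar>y\<bar> \<le> L\<close> the function \<open>- (drift y / drift 0) \<bar>x - y\<bar>\<close>
  has drift \<open>- drift y\<close> at \<open>y\<close> and nonpositive drift elsewhere; after subtraction of its value at
  \<open>0\<close> it is at most \<open>(drift y / drift 0) \<bar>x\<bar>\<close> in absolute value, and the sum of these bounds is at
  most \<open>\<epsilon> \<bar>x\<bar>\<close> if \<open>K\<close> is large. On \<open>[-K, K]\<close> the Foster function
  \<open>w\<close> with target \<open>0\<close> is used. The cutoff \<open>L\<close> keeps the sum finite, and the error constant does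
  not depend on it.
\<close>
lemma approximate_potential_kernel:
  assumes "0 < \<epsilon>"
  shows "\<exists>c\<ge>0. \<forall>L::nat. \<exists>g. (\<forall>x. \<bar>g x - \<bar>real_of_int x\<bar>\<bar> \<le> \<epsilon> * \<bar>real_of_int x\<bar> + c) \<and>
    (\<forall>x. x \<noteq> 0 \<longrightarrow> \<bar>x\<bar> \<le> int L \<longrightarrow> step g x \<le> g x)"
proof -
  obtain K where K: "\<And>L. (\<Sum>y\<in>{y. int K < \<bar>y\<bar> \<and> \<bar>y\<bar> \<le> int L}. drift y) \<le> \<epsilon> * drift 0"
    using drift_tail[of "\<epsilon> * drift 0"] assms drift_zero_pos by auto
  obtain w b where w: "\<And>x. 0 \<le> w x" "\<And>x. w x \<le> b"
    and stepw: "\<And>x. x \<noteq> 0 \<Longrightarrow> step w x \<le> w x - (if x \<in> {-int K..int K} then 1 else 0)"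
    using foster_function[of "{-int K..int K}" "{0}"] by auto
  have b: "0 \<le> b" using w order_trans by blast
  have "\<exists>g. (\<forall>x. \<bar>g x - \<bar>real_of_int x\<bar>\<bar> \<le> \<epsilon> * \<bar>real_of_int x\<bar> + drift 0 * b) \<and>
    (\<forall>x. x \<noteq> 0 \<longrightarrow> \<bar>x\<bar> \<le> int L \<longrightarrow> step g x \<le> g x)" for L :: nat
  proof -
    define T where "T = {y. int K < \<bar>y\<bar> \<and> \<bar>y\<bar> \<le> int L}"
    have finT: "finite T"
      by (rule finite_subset[of _ "{-int L..int L}"]) (auto simp: T_def)
    \<comment> \<open>Subtracting the values at the origin keeps each summand below its weight times \<open>\<bar>x\<bar>\<close>.\<close>
    define \<psi> where "\<psi> x = (\<Sum>y\<in>T. drift y * (\<bar>real_of_int y\<bar> - \<bar>real_of_int (x - y)\<bar>)) / drift 0" for x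
    define g where "g x = \<bar>real_of_int x\<bar> + \<psi> x + drift 0 * w x" for x
    have psi: "\<bar>\<psi> x\<bar> \<le> \<epsilon> * \<bar>real_of_int x\<bar>" for x
    proof -
      have "\<bar>\<Sum>y\<in>T. drift y * (\<bar>real_of_int y\<bar> - \<bar>real_of_int (x - y)\<bar>)\<bar> \<le> (\<Sum>y\<in>T. drift y * \<bar>real_of_int x\<bar>)"
        by (rule order_trans[OF sum_abs]) (auto intro!: sum_mono mult_left_mono simp: abs_mult drift_nonneg)
      also have "\<dots> \<le> (\<epsilon> * drift 0) * \<bar>real_of_int x\<bar>"
        unfolding sum_distrib_right[symmetric] using K[of L] by (intro mult_right_mono) (auto simp: T_def)
      finally show ?thesis
        using drift_zero_pos by (simp add: \<psi>_def field_simps)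
    qed
    have "\<bar>g x - \<bar>real_of_int x\<bar>\<bar> \<le> \<epsilon> * \<bar>real_of_int x\<bar> + drift 0 * b" for x
    proof -
      have "0 \<le> drift 0 * w x" "drift 0 * w x \<le> drift 0 * b"
        using w drift_zero_pos by auto
      then show ?thesis using psi[of x] by (simp add: g_def abs_le_iff)
    qed
    moreover have "step g x \<le> g x" if x: "x \<noteq> 0" "\<bar>x\<bar> \<le> int L" for x
    proof -
      have abs_drift: "(\<integral>k. \<bar>real_of_int (x + k - y)\<bar> \<partial>\<mu>) = \<bar>real_of_int (x - y)\<bar> + drift (x - y)" for y
        by (simp add: drift_def step_def algebra_simps)
      have iabs: "integrable \<mu> (\<lambda>k. \<bar>real_of_int (x + k - y)\<bar>)" for y
        using integrable_abs_shift[of "x - y"] by (simp add: algebra_simps)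
      have step_psi: "(\<integral>k. \<psi> (x + k) \<partial>\<mu>) = \<psi> x - (\<Sum>y\<in>T. drift y * drift (x - y)) / drift 0"
      proof -
        have "(\<integral>k. \<psi> (x + k) \<partial>\<mu>) =
          (\<Sum>y\<in>T. drift y * (\<bar>real_of_int y\<bar> - (\<integral>k. \<bar>real_of_int (x + k - y)\<bar> \<partial>\<mu>))) / drift 0"
          unfolding \<psi>_def using iabs
          by (subst Bochner_Integration.integral_divide_zero, subst Bochner_Integration.integral_sum)
            (auto simp: prob_space[simplified] Bochner_Integration.integral_diff)
        also have "\<dots> = \<psi> x - (\<Sum>y\<in>T. drift y * drift (x - y)) / drift 0"
          unfolding abs_drift \<psi>_def
          by (simp add: diff_divide_distrib[symmetric] sum_subtractf[symmetric] algebra_simps)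
        finally show ?thesis .
      qed
      have ipsi: "integrable \<mu> (\<lambda>k. \<psi> (x + k))"
        unfolding \<psi>_def using iabs by (intro Bochner_Integration.integrable_divide_zero Bochner_Integration.integrable_sum Bochner_Integration.integrable_mult_right Bochner_Integration.integrable_diff) auto
      have iw: "integrable \<mu> (\<lambda>k. w (x + k))"
        using w by (intro integrable_bounded[of _ b]) auto
      have "step g x = (\<integral>k. \<bar>real_of_int (x + k)\<bar> \<partial>\<mu>) + (\<integral>k. \<psi> (x + k) \<partial>\<mu>) + drift 0 * step w x"
        unfolding step_def g_def using ipsi iw integrable_abs_shift[of x] by simp
      also have "\<dots> = \<bar>real_of_int x\<bar> + drift x + \<psi> x - (\<Sum>y\<in>T. drift y * drift (x - y)) / drift 0 + drift 0 * step w x"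
        using abs_drift[of 0] step_psi by simp
      also have "\<dots> \<le> g x"
      \<comment> \<open>The drift at \<open>x\<close> is paid by the summand \<open>y = x\<close> of \<open>\<psi>\<close> if \<open>x\<close> is far, and by \<open>w\<close> if \<open>x\<close> is near.\<close>
      proof (cases "x \<in> T")
        case True
        have "drift x * drift 0 \<le> (\<Sum>y\<in>T. drift y * drift (x - y))"
          using member_le_sum[OF True, of "\<lambda>y. drift y * drift (x - y)"] finT by (simp add: drift_nonneg)
        then have "drift x \<le> (\<Sum>y\<in>T. drift y * drift (x - y)) / drift 0"
          using drift_zero_pos by (simp add: field_simps)
        moreover have "step w x \<le> w x" using stepw[OF x(1)] by (simp split: if_splits)
        moreover have "drift 0 * step w x \<le> drift 0 * w x"
          using calculation(2) drift_zero_pos by simp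
        ultimately show ?thesis unfolding g_def by linarith
      next
        case False
        then have "x \<in> {-int K..int K}" using x by (auto simp: T_def)
        then have "drift 0 * step w x \<le> drift 0 * (w x - 1)"
          using stepw[OF x(1)] drift_zero_pos by (intro mult_left_mono) auto
        moreover have "0 \<le> (\<Sum>y\<in>T. drift y * drift (x - y)) / drift 0"
          by (intro divide_nonneg_nonneg sum_nonneg mult_nonneg_nonneg drift_nonneg)
        ultimately show ?thesis using drift_le[of x] by (simp add: g_def algebra_simps)
      qed
      finally show ?thesis .
    qed
    ultimately show ?thesis by blast
  qed
  then show ?thesis using b drift_nonneg[of 0] by (intro exI[of _ "drift 0 * b"]) auto
qed

end

section \<open>Bounded functions that are subharmonic off one site\<close>

text \<open>
  The piecewise linear function with zeros at \<open>\<plusminus>n\<close> and a single kink at \<open>z\<close>, extended linearly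
  beyond \<open>\<plusminus>n\<close>. Writing it as a linear function minus \<open>\<bar>x - z\<bar> / n\<close> isolates the only
  part that is not harmonic for a centred walk.
\<close>
definition tent :: "nat \<Rightarrow> int \<Rightarrow> int \<Rightarrow> real" where
  "tent n z x = 1 - real_of_int z * real_of_int x / (real n)\<^sup>2 - \<bar>real_of_int (x - z)\<bar> / real n"

lemma sum_abs_symmetric_interval:
  assumes "\<bar>z\<bar> \<le> int n"
  shows "(\<Sum>x\<in>{-int n..int n}. \<bar>real_of_int (x - z)\<bar>) = (real n)\<^sup>2 + (real_of_int z)\<^sup>2 + real n"
proof -
  have tri: "(\<Sum>i\<in>{1..int j}. real_of_int i) = real j * (real j + 1) / 2" for j :: nat
  proof (induction j)
    case (Suc j)
    have "{1..int (Suc j)} = insert (int (Suc j)) {1..int j}" by auto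
    then show ?case using Suc by (simp add: field_simps)
  qed simp
  have "{-int n..int n} = {-int n..z} \<union> {z+1..int n}" using assms by auto
  then have "(\<Sum>x\<in>{-int n..int n}. \<bar>real_of_int (x - z)\<bar>) =
      (\<Sum>x\<in>{-int n..z}. \<bar>real_of_int (x - z)\<bar>) + (\<Sum>x\<in>{z+1..int n}. \<bar>real_of_int (x - z)\<bar>)"
    by (simp only:) (subst sum.union_disjoint, auto)
  also have "(\<Sum>x\<in>{z+1..int n}. \<bar>real_of_int (x - z)\<bar>) = (\<Sum>i\<in>{1..int (nat (int n - z))}. real_of_int i)"
    by (rule sum.reindex_bij_witness[of _ "\<lambda>i. i + z" "\<lambda>x. x - z"]) (use assms in \<open>auto split: if_splits\<close>)
  also have "(\<Sum>x\<in>{-int n..z}. \<bar>real_of_int (x - z)\<bar>) = (\<Sum>i\<in>{0..int (nat (int n + z))}. real_of_int i)"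
    by (rule sum.reindex_bij_witness[of _ "\<lambda>i. z - i" "\<lambda>x. z - x"]) (use assms in \<open>auto split: if_splits\<close>)
  also have "{0..int (nat (int n + z))} = insert 0 {1..int (nat (int n + z))}" using assms by auto
  also have "(\<Sum>i\<in>insert 0 {1..int (nat (int n + z))}. real_of_int i) = (\<Sum>i\<in>{1..int (nat (int n + z))}. real_of_int i)"
    by simp
  finally show ?thesis
    using assms unfolding tri by (simp add: field_simps power2_eq_square)
qed

lemma sum_tent:
  assumes "\<bar>z\<bar> \<le> int n" "0 < n"
  shows "(\<Sum>x\<in>{-int n..int n}. tent n z x) = real n - (real_of_int z)\<^sup>2 / real n"
proof -
  have "(\<Sum>x\<in>{-int n..int n}. real_of_int x) = (\<Sum>x\<in>{-int n..int n}. - real_of_int x)"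
    by (rule sum.reindex_bij_witness[of _ uminus uminus]) auto
  then have zero: "(\<Sum>x\<in>{-int n..int n}. real_of_int x) = 0"
    by (simp add: sum_negf)
  have "(\<Sum>x\<in>{-int n..int n}. tent n z x) =
     (2 * real n + 1) - real_of_int z * (\<Sum>x\<in>{-int n..int n}. real_of_int x) / (real n)\<^sup>2
      - (\<Sum>x\<in>{-int n..int n}. \<bar>real_of_int (x - z)\<bar>) / real n"
    unfolding tent_def by (simp only: sum_subtractf sum_divide_distrib sum_distrib_left) simp
  also have "\<dots> = real n - (real_of_int z)\<^sup>2 / real n"
    unfolding sum_abs_symmetric_interval[OF assms(1)] zero
    using assms(2) by (simp add: field_simps power2_eq_square)
  finally show ?thesis .
qed

text \<open>
  Up to the factor \<open>n\<^sup>2\<close>, the tent is \<open>(n + z) (n - x)\<close> to the right of \<open>z\<close> and \<open>(n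
  - z) (n + x)\<close> to the left.
\<close>
lemma tent_nonneg:
  assumes "\<bar>z\<bar> \<le> int n" "\<bar>x\<bar> \<le> int n" "0 < n"
  shows "0 \<le> tent n z x"
proof -
  have b: "\<bar>real_of_int z\<bar> \<le> real n" "\<bar>real_of_int x\<bar> \<le> real n"
    using assms by linarith+
  have "(real n)\<^sup>2 * tent n z x = (real n)\<^sup>2 - z * x - real n * \<bar>real_of_int (x - z)\<bar>"
    using assms(3) by (simp add: tent_def field_simps power2_eq_square)
  also have "\<dots> \<ge> 0"
  proof (cases "z \<le> x")
    case True
    have "0 \<le> (real n + z) * (real n - x)" using b by (intro mult_nonneg_nonneg) linarith+
    then show ?thesis using True by (simp add: algebra_simps power2_eq_square)
  next
    case False
    have "0 \<le> (real n - z) * (real n + x)" using b by (intro mult_nonneg_nonneg) linarith+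
    then show ?thesis using False by (simp add: algebra_simps power2_eq_square)
  qed
  finally show ?thesis using assms(3) by (simp add: zero_le_mult_iff)
qed

text \<open>
  Beyond \<open>\<plusminus>n\<close> the tent decreases with slope at least \<open>\<epsilon> / n\<close>, which dominates the linear
  error of slope \<open>\<delta> / n\<close>; the error accumulated between \<open>z\<close> and the end of the interval is at most
  \<open>2 \<delta>\<close>.
\<close>
lemma tent_outside:
  assumes z: "\<bar>real_of_int z\<bar> \<le> (1 - \<epsilon>) * real n" and x: "int n < \<bar>x\<bar>"
    and "0 < n" "0 \<le> \<delta>" "\<delta> \<le> \<epsilon>" "\<epsilon> \<le> 1"
  shows "tent n z x + \<delta> * \<bar>real_of_int (x - z)\<bar> / real n \<le> 2 * \<delta>"
proof -
  define N where "N = real n"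
  have N: "0 < N" using assms by (simp add: N_def)
  have zN: "\<bar>real_of_int z\<bar> \<le> N - \<epsilon> * N" using z by (simp add: N_def algebra_simps)
  have eN: "\<delta> * N \<le> \<epsilon> * N" "0 \<le> \<delta> * N" using assms N by auto
  \<comment> \<open>The right half, multiplied by \<open>n\<^sup>2\<close>; the left half follows by reflection of both \<open>x\<close> and \<open>z\<close>.\<close>
  have key: "(N + a) * (N - y) + \<delta> * N * (y - a) \<le> 2 * \<delta> * N * N"
    if "\<bar>a\<bar> \<le> N - \<epsilon> * N" "N \<le> y" for a y :: real
  proof -
    have "\<delta> * N * (y - a) = \<delta> * N * (y - N) + \<delta> * N * (N - a)" by (simp add: algebra_simps)
    also have "\<delta> * N * (N - a) \<le> \<delta> * N * (2 * N)"
      using that eN by (intro mult_left_mono) auto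
    also have "\<delta> * N * (y - N) \<le> (N + a) * (y - N)"
      using that eN by (intro mult_right_mono) auto
    finally show ?thesis by (simp add: algebra_simps)
  qed
  have "N\<^sup>2 * (tent n z x + \<delta> * \<bar>real_of_int (x - z)\<bar> / N) = N\<^sup>2 - z * x - N * \<bar>real_of_int (x - z)\<bar> + \<delta> * N * \<bar>real_of_int (x - z)\<bar>"
    using N by (simp add: tent_def N_def[symmetric] field_simps power2_eq_square)
  also have "\<dots> \<le> 2 * \<delta> * N * N"
  proof (cases "0 \<le> x")
    case True
    then have "N \<le> x" using x by (simp add: N_def) 
    moreover have "z \<le> x" using \<open>N \<le> x\<close> zN eN by linarith
    ultimately show ?thesis using key[of z x] zN by (simp add: algebra_simps power2_eq_square)
  next
    case False
    then have "N \<le> - x" using x by (simp add: N_def)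
    moreover have "x \<le> z" using \<open>N \<le> - x\<close> zN eN by linarith
    ultimately show ?thesis using key[of "- z" "- x"] zN by (simp add: algebra_simps power2_eq_square)
  qed
  also have "\<dots> = N\<^sup>2 * (2 * \<delta>)" by (simp add: power2_eq_square)
  finally show ?thesis using N by (simp add: N_def)
qed

context increment_law
begin

text \<open>
  With \<open>g\<close> the approximate potential kernel, the tent with \<open>\<bar>x - z\<bar>\<close> replaced by \<open>g (x -
  z)\<close> is subharmonic off \<open>z\<close> in the range where \<open>g\<close> is superharmonic, and \<open>f\<close> is its
  positive part, which is still subharmonic. The range \<open>L\<close> is chosen so large that outside it the positive part vanishes
  and there is nothing to check. The last property compares a sum over any set of \<open>2 n + 1\<close> sites with \<open>2 n
  f(0)\<close>: the sum exceeds that of the tent over \<open>[-n, n]\<close> by at most \<open>(2 n + 1) \<eta>\<close>, where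
  \<open>\<eta> = 2 \<delta> + c / n\<close> bounds the error.
\<close>
lemma barrier:
  assumes "0 < \<epsilon>" "\<epsilon> \<le> 1"
  shows "\<exists>B c n0. 0 < B \<and> 0 < c \<and> (\<forall>n\<ge>n0. \<forall>z. \<bar>real_of_int z\<bar> \<le> (1 - \<epsilon>) * real n \<longrightarrow>
    (\<exists>f. (\<forall>x. 0 \<le> f x \<and> f x \<le> B) \<and> (\<forall>x. x \<noteq> z \<longrightarrow> f x \<le> step f x) \<and>
       (\<forall>C. finite C \<and> card C \<le> 2 * n + 1 \<longrightarrow> sum f C \<le> 2 * real n * f 0 - c * real n)))"
proof -
  \<comment> \<open>The gain is at least \<open>\<epsilon>\<^sup>2 n\<close> and the errors cost at most \<open>8 \<delta> n + 5 c\<close>; this choice of \<open>\<delta>\<close> and \<open>n0\<close> leaves \<open>\<epsilon>\<^sup>2 n / 4\<close>.\<close>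
  define \<delta> where "\<delta> = \<epsilon>\<^sup>2 / 16"
  have "\<epsilon> * \<epsilon> \<le> \<epsilon> * 1" using assms by (intro mult_left_mono) auto
  then have \<delta>: "0 < \<delta>" "2 * \<delta> \<le> \<epsilon>" using assms by (auto simp: \<delta>_def power2_eq_square)
  obtain c where c: "0 \<le> c" and kernel: "\<And>L::nat. \<exists>g. (\<forall>x. \<bar>g x - \<bar>real_of_int x\<bar>\<bar> \<le> \<delta> * \<bar>real_of_int x\<bar> + c) \<and>
    (\<forall>x. x \<noteq> 0 \<longrightarrow> \<bar>x\<bar> \<le> int L \<longrightarrow> step g x \<le> g x)"
    using approximate_potential_kernel[OF \<delta>(1)] by blast
  define n0 where "n0 = Suc (nat \<lceil>20 * c / \<epsilon>\<^sup>2\<rceil>)"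
  have "\<exists>f. (\<forall>x. 0 \<le> f x \<and> f x \<le> 1 + c) \<and> (\<forall>x. x \<noteq> z \<longrightarrow> f x \<le> step f x) \<and>
       (\<forall>C. finite C \<and> card C \<le> 2 * n + 1 \<longrightarrow> sum f C \<le> 2 * real n * f 0 - \<epsilon>\<^sup>2 / 4 * real n)"
    if n: "n \<ge> n0" and z: "\<bar>real_of_int z\<bar> \<le> (1 - \<epsilon>) * real n" for n z
  proof -
    have n1: "n \<ge> 1" using n by (simp add: n0_def)
    have "20 * c / \<epsilon>\<^sup>2 \<le> real n"
      using n of_nat_ceiling[of "20 * c / \<epsilon>\<^sup>2"] unfolding n0_def by linarith
    then have nc: "20 * c \<le> \<epsilon>\<^sup>2 * real n" using assms by (simp add: field_simps)
    have "0 \<le> \<epsilon> * real n" using assms by simp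
    then have zn: "\<bar>real_of_int z\<bar> \<le> real n" using z by (simp add: algebra_simps)
    then have zn': "\<bar>z\<bar> \<le> int n" by linarith
    define L where "L = nat \<lceil>2 * (real n + c) / \<epsilon>\<rceil>"
    obtain g where g: "\<And>x. \<bar>g x - \<bar>real_of_int x\<bar>\<bar> \<le> \<delta> * \<bar>real_of_int x\<bar> + c"
      and gsup: "\<And>x. x \<noteq> 0 \<Longrightarrow> \<bar>x\<bar> \<le> int L \<Longrightarrow> step g x \<le> g x"
      using kernel[of L] by blast
    define h where "h x = 1 - real_of_int z * real_of_int x / (real n)\<^sup>2 - g (x - z) / real n" for x
    define f where "f x = max 0 (h x)" for x
    have h_tent: "\<bar>h x - tent n z x\<bar> \<le> (\<delta> * \<bar>real_of_int (x - z)\<bar> + c) / real n" for x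
    proof -
      have "h x - tent n z x = - (g (x - z) - \<bar>real_of_int (x - z)\<bar>) / real n"
        unfolding h_def tent_def by (simp add: diff_divide_distrib)
      then have "\<bar>h x - tent n z x\<bar> = \<bar>g (x - z) - \<bar>real_of_int (x - z)\<bar>\<bar> / real n"
        by (simp only: abs_divide abs_minus_cancel abs_of_nat)
      then show ?thesis using g[of "x - z"] by (simp add: divide_right_mono)
    qed
    have h_le: "h x \<le> 1 + c / real n - \<epsilon> / 2 * \<bar>real_of_int (x - z)\<bar> / real n" for x
    proof -
      define u where "u = real_of_int (x - z)"
      have "- real_of_int z * u \<le> \<bar>real_of_int z\<bar> * \<bar>u\<bar>" by (metis abs_ge_self abs_minus_cancel abs_mult mult_minus_left)
      also have "\<dots> \<le> (1 - \<epsilon>) * real n * \<bar>u\<bar>" using z by (intro mult_right_mono) auto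
      finally have "- real_of_int z * u / (real n)\<^sup>2 \<le> (1 - \<epsilon>) * real n * \<bar>u\<bar> / (real n)\<^sup>2" by (rule divide_right_mono) simp
      also have "\<dots> = (1 - \<epsilon>) * \<bar>u\<bar> / real n" by (simp add: power2_eq_square)
      finally have "- real_of_int z * u / (real n)\<^sup>2 \<le> (1 - \<epsilon>) * \<bar>u\<bar> / real n" .
      moreover have "tent n z x = 1 - (real_of_int z)\<^sup>2 / (real n)\<^sup>2 + (- real_of_int z * u / (real n)\<^sup>2) - \<bar>u\<bar> / real n"
        by (simp add: tent_def u_def left_diff_distrib right_diff_distrib diff_divide_distrib power2_eq_square mult.commute)
      moreover have "0 \<le> (real_of_int z)\<^sup>2 / (real n)\<^sup>2" by simp
      moreover have "(1 - \<epsilon>) * \<bar>u\<bar> / real n = \<bar>u\<bar> / real n - \<epsilon> * \<bar>u\<bar> / real n"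
        by (simp add: left_diff_distrib diff_divide_distrib)
      ultimately have "tent n z x \<le> 1 - \<epsilon> * \<bar>u\<bar> / real n"
        by linarith
      moreover have "h x \<le> tent n z x + \<delta> * \<bar>u\<bar> / real n + c / real n"
        using h_tent[of x] by (simp add: u_def abs_le_iff add_divide_distrib)
      moreover have "\<delta> * \<bar>u\<bar> / real n \<le> \<epsilon> / 2 * \<bar>u\<bar> / real n"
        using \<delta> by (intro divide_right_mono mult_right_mono) auto
      ultimately show ?thesis by (simp add: u_def)
    qed
    have cn: "c / real n \<le> c" using divide_left_mono[of 1 "real n" c] n1 c by simp
    have f_bounds: "0 \<le> f x \<and> f x \<le> 1 + c" for x
    proof -
      have "0 \<le> \<epsilon> / 2 * \<bar>real_of_int (x - z)\<bar> / real n" using assms by simp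
      then show ?thesis using h_le[of x] cn c by (simp add: f_def)
    qed
    have f_int: "integrable \<mu> (\<lambda>k. f (x + k))" for x
      using f_bounds by (intro integrable_bounded[of _ "1 + c"]) simp
    have f_sub: "f x \<le> step f x" if "x \<noteq> z" for x
    proof (cases "h x \<le> 0")
      case True
      then show ?thesis using f_bounds by (simp add: f_def step_def)
    next
      case False
      have far: "\<bar>x - z\<bar> \<le> int L"
      proof -
        have "\<epsilon> / 2 * \<bar>real_of_int (x - z)\<bar> / real n \<le> 1 + c / real n"
          using False h_le[of x] by simp
        then have "\<bar>real_of_int (x - z)\<bar> \<le> 2 * (real n + c) / \<epsilon>"
          using n1 assms by (simp add: field_simps)
        then show ?thesis unfolding L_def by linarith
      qed
      have ig: "integrable \<mu> (\<lambda>k. g (x - z + k))"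
      proof (rule integrable_linear_growth)
        fix k
        have "\<bar>g (x - z + k)\<bar> \<le> (1 + \<delta>) * \<bar>real_of_int (x - z + k)\<bar> + c"
          using g[of "x - z + k"] by (simp add: algebra_simps)
        also have "\<dots> \<le> (1 + \<delta>) * (\<bar>real_of_int k\<bar> + \<bar>real_of_int (x - z)\<bar>) + c"
          using \<delta> by (intro add_right_mono mult_left_mono) auto
        finally show "\<bar>g (x - z + k)\<bar> \<le> (1 + \<delta>) * \<bar>real_of_int k\<bar> + ((1 + \<delta>) * \<bar>real_of_int (x - z)\<bar> + c)"
          by (simp add: algebra_simps)
      qed
      have shift: "x + k - z = x - z + k" for k by simp
      have ik: "integrable \<mu> (\<lambda>k. real_of_int k)"
        by (rule integrable_linear_growth[of _ 1 0]) simp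
      have hk: "h (x + k) = 1 - real_of_int z * real_of_int x / (real n)\<^sup>2 - real_of_int z / (real n)\<^sup>2 * real_of_int k - g (x - z + k) / real n" for k
        unfolding h_def shift by (simp add: field_simps add_divide_distrib)
      have ih: "integrable \<mu> (\<lambda>k. h (x + k))"
        unfolding hk using ig ik by simp
      have "h x \<le> 1 - real_of_int z * real_of_int x / (real n)\<^sup>2 - step g (x - z) / real n"
        using gsup[OF _ far] that n1 by (simp add: h_def divide_right_mono)
      also have "\<dots> = (\<integral>k. h (x + k) \<partial>\<mu>)"
        unfolding hk using ig ik centred by (simp add: step_def prob_space[simplified])
      also have "\<dots> \<le> step f x"
        unfolding step_def by (intro integral_mono ih f_int) (simp add: f_def)
      finally show ?thesis using False by (simp add: f_def)
    qed
    define \<eta> where "\<eta> = 2 * \<delta> + c / real n"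
    have \<eta>: "0 \<le> \<eta>" using \<delta> c by (simp add: \<eta>_def)
    have f_inside: "f x \<le> tent n z x + \<eta>" if "x \<in> {-int n..int n}" for x
    proof -
      have x: "\<bar>x\<bar> \<le> int n" using that by auto
      have "\<bar>real_of_int (x - z)\<bar> \<le> 2 * real n" using x zn' by linarith
      then have "\<delta> * \<bar>real_of_int (x - z)\<bar> / real n \<le> \<delta> * (2 * real n) / real n"
        using \<delta> by (intro divide_right_mono mult_left_mono) auto
      also have "\<dots> = 2 * \<delta>" using n1 by simp
      finally have "h x \<le> tent n z x + \<eta>"
        using h_tent[of x] by (simp add: \<eta>_def abs_le_iff add_divide_distrib)
      then show ?thesis
        using tent_nonneg[OF zn' x] n1 \<eta> by (simp add: f_def)
    qed
    have f_outside: "f x \<le> \<eta>" if "x \<notin> {-int n..int n}" for x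
    proof -
      have "int n < \<bar>x\<bar>" using that by auto
      from tent_outside[OF z this, of \<delta>] have "tent n z x + \<delta> * \<bar>real_of_int (x - z)\<bar> / real n \<le> 2 * \<delta>"
        using n1 \<delta> assms by simp
      then have "h x \<le> \<eta>"
        using h_tent[of x] by (simp add: \<eta>_def abs_le_iff add_divide_distrib)
      then show ?thesis using \<eta> by (simp add: f_def)
    qed
    have "sum f C \<le> 2 * real n * f 0 - \<epsilon>\<^sup>2 / 4 * real n" if C: "finite C" "card C \<le> 2 * n + 1" for C
    proof -
      let ?I = "{-int n..int n}"
      have "sum f C \<le> (\<Sum>x\<in>C. (if x \<in> ?I then tent n z x else 0) + \<eta>)"
        using f_inside f_outside by (intro sum_mono) auto
      also have "\<dots> = (\<Sum>x\<in>C \<inter> ?I. tent n z x) + real (card C) * \<eta>"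
        using C by (simp add: sum.distrib sum.inter_restrict)
      also have "(\<Sum>x\<in>C \<inter> ?I. tent n z x) \<le> (\<Sum>x\<in>?I. tent n z x)"
        using n1 by (intro sum_mono2) (auto intro!: tent_nonneg zn')
      also have "\<dots> = real n - (real_of_int z)\<^sup>2 / real n"
        using n1 by (intro sum_tent zn') auto
      also have "real (card C) * \<eta> \<le> real (2 * n + 1) * \<eta>"
        using C \<eta> by (intro mult_right_mono) linarith+
      finally have upper: "sum f C \<le> real n - (real_of_int z)\<^sup>2 / real n + (2 * real n + 1) * \<eta>"
        by (simp add: add.commute)
      have "tent n z 0 - (\<delta> * \<bar>real_of_int z\<bar> + c) / real n \<le> f 0"
        using h_tent[of 0] by (simp add: f_def)
      then have "2 * real n * (1 - \<bar>real_of_int z\<bar> / real n - (\<delta> * \<bar>real_of_int z\<bar> + c) / real n) \<le> 2 * real n * f 0"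
        by (intro mult_left_mono) (simp_all add: tent_def)
      moreover have "2 * real n * (1 - \<bar>real_of_int z\<bar> / real n - (\<delta> * \<bar>real_of_int z\<bar> + c) / real n) =
          2 * real n - 2 * \<bar>real_of_int z\<bar> - 2 * (\<delta> * \<bar>real_of_int z\<bar>) - 2 * c"
        using n1 by (simp add: right_diff_distrib)
      moreover have "\<delta> * \<bar>real_of_int z\<bar> \<le> \<delta> * real n" using zn \<delta> by simp
      moreover have "2 * (\<delta> * real n) = 2 * \<delta> * real n" by simp
      ultimately have lower: "2 * real n - 2 * \<bar>real_of_int z\<bar> - 2 * \<delta> * real n - 2 * c \<le> 2 * real n * f 0"
        by linarith
      \<comment> \<open>The gain \<open>n (1 - \<bar>z\<bar> / n)\<^sup>2\<close>.\<close>
      have "(\<epsilon> * real n)\<^sup>2 \<le> (real n - \<bar>real_of_int z\<bar>)\<^sup>2"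
        using z assms by (intro power_mono) (auto simp: algebra_simps)
      then have "(\<epsilon> * real n)\<^sup>2 / real n \<le> (real n - \<bar>real_of_int z\<bar>)\<^sup>2 / real n"
        by (rule divide_right_mono) simp
      then have square: "\<epsilon>\<^sup>2 * real n \<le> real n - 2 * \<bar>real_of_int z\<bar> + (real_of_int z)\<^sup>2 / real n"
        using n1 by (simp add: power2_diff field_simps power2_eq_square)
      have "(2 * real n + 1) * \<eta> = 4 * \<delta> * real n + 2 * \<delta> + 2 * c + c / real n"
        using n1 by (simp add: \<eta>_def field_simps)
      moreover have "2 * \<delta> \<le> 2 * \<delta> * real n" using n1 \<delta>(1) by simp
      ultimately have "(2 * real n + 1) * \<eta> \<le> 6 * \<delta> * real n + 3 * c"
        using cn by linarith
      moreover have "8 * \<delta> * real n = \<epsilon>\<^sup>2 * real n / 2" by (simp add: \<delta>_def)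
      ultimately show ?thesis using upper lower square nc by linarith
    qed
    then show ?thesis using f_bounds f_sub by blast
  qed
  then show ?thesis using c assms by (intro exI[of _ "1 + c"] exI[of _ "\<epsilon>\<^sup>2 / 4"] exI[of _ n0]) auto
qed

end

section \<open>Settling of a walk and growth of clusters\<close>

text \<open>
  Increments numbered from \<open>0\<close>, so that prepending one to a path is \<^const>\<open>case_nat\<close>.
\<close>
definition walk_from :: "int \<Rightarrow> (nat \<Rightarrow> int) \<Rightarrow> nat \<Rightarrow> int" where
  "walk_from x \<omega> n = x + (\<Sum>i<n. \<omega> i)"

lemma walk_eq_walk_from: "walk x \<xi> = walk_from x (\<lambda>i. \<xi> (Suc i))"
  by (rule ext) (simp add: walk_def walk_from_def sum.atLeast1_atMost_eq)

lemma walk_from_0 [simp]: "walk_from x \<omega> 0 = x"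
  by (simp add: walk_from_def)

lemma walk_from_case_nat [simp]: "walk_from x (case_nat k \<omega>) (Suc n) = walk_from (x + k) \<omega> n"
  by (simp add: walk_from_def sum.lessThan_Suc_shift del: sum.lessThan_Suc)

lemma exit_time_eq_enat: "exit_time S C = enat n \<longleftrightarrow> S n \<notin> C \<and> (\<forall>j<n. S j \<in> C)"
proof (cases "\<exists>n. S n \<notin> C")
  case True
  define l where "l = (LEAST n. S n \<notin> C)"
  have l: "S l \<notin> C" "\<And>j. S j \<notin> C \<Longrightarrow> l \<le> j"
    using LeastI_ex[OF True] by (auto simp: l_def intro: Least_le)
  have "exit_time S C = enat l"
    unfolding exit_time_def by (intro antisym INF_lower INF_greatest) (use l in auto)
  then show ?thesis
    using l by (metis enat.inject leD linorder_neqE_nat)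
next
  case False
  then have "exit_time S C = \<infinity>" by (simp add: exit_time_def top_enat_def)
  then show ?thesis using False by simp
qed

lemma exit_time_eq_infinity: "exit_time S C = \<infinity> \<longleftrightarrow> (\<forall>n. S n \<in> C)"
proof
  assume "exit_time S C = \<infinity>"
  show "\<forall>n. S n \<in> C"
  proof (rule ccontr)
    assume "\<not> (\<forall>n. S n \<in> C)"
    then obtain n where "S n \<notin> C" "\<forall>j<n. S j \<in> C"
      using exists_least_iff[of "\<lambda>n. S n \<notin> C"] by blast
    then have "exit_time S C = enat n" by (simp add: exit_time_eq_enat)
    then show False using \<open>exit_time S C = \<infinity>\<close> by simp
  qed
qed (simp add: exit_time_def top_enat_def)

text \<open>
  The value \<open>0\<close> for a walk that never exits makes \<open>sum_settle\<close> hold for every path; for \<open>f \<ge>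
  0\<close> it is also the least favourable one in a lower bound.
\<close>
definition exit_value :: "(int \<Rightarrow> real) \<Rightarrow> int set \<Rightarrow> (nat \<Rightarrow> int) \<Rightarrow> real" where
  "exit_value f C S = (case exit_time S C of enat n \<Rightarrow> f (S n) | \<infinity> \<Rightarrow> 0)"

definition settle :: "int set \<Rightarrow> (nat \<Rightarrow> int) \<Rightarrow> int set" where
  "settle C S = (case exit_time S C of enat n \<Rightarrow> insert (S n) C | \<infinity> \<Rightarrow> C)"

lemma finite_settle: "finite C \<Longrightarrow> finite (settle C S)"
  by (simp add: settle_def split: enat.splits)

lemma subset_settle: "C \<subseteq> settle C S"
  by (auto simp: settle_def split: enat.splits)

lemma card_settle_le: "finite C \<Longrightarrow> card (settle C S) \<le> Suc (card C)"
  by (auto simp: settle_def card_insert_if split: enat.splits)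

lemma sum_settle:
  assumes "finite C"
  shows "sum f (settle C S) = sum f C + exit_value f C S"
proof (cases "exit_time S C")
  case (enat n)
  then have "S n \<notin> C" by (simp add: exit_time_eq_enat)
  then show ?thesis using enat assms by (simp add: settle_def exit_value_def)
qed (simp add: settle_def exit_value_def)

lemma exit_value_first_step:
  "exit_value f C (walk_from x (case_nat k \<omega>)) =
    (if x \<in> C then exit_value f C (walk_from (x + k) \<omega>) else f x)"
proof (cases "x \<in> C")
  case True
  show ?thesis
  proof (cases "exit_time (walk_from (x + k) \<omega>) C")
    case (enat n)
    then have "exit_time (walk_from x (case_nat k \<omega>)) C = enat (Suc n)"
      using True by (auto simp: exit_time_eq_enat less_Suc_eq_0_disj)
    then show ?thesis using enat True by (simp add: exit_value_def)
  next
    case infinity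
    have "walk_from x (case_nat k \<omega>) n \<in> C" for n
      using infinity True by (cases n) (auto simp: exit_time_eq_infinity)
    then have "exit_time (walk_from x (case_nat k \<omega>)) C = \<infinity>"
      by (simp add: exit_time_eq_infinity)
    then show ?thesis using infinity True by (simp add: exit_value_def)
  qed
next
  case False
  then have "exit_time (walk_from x (case_nat k \<omega>)) C = enat 0"
    by (simp add: exit_time_eq_enat)
  then show ?thesis using False by (simp add: exit_value_def)
qed

abbreviation path_space :: "(nat \<Rightarrow> int) measure" where
  "path_space \<equiv> \<Pi>\<^sub>M i\<in>UNIV. count_space UNIV"

text \<open>
  Clusters range over a countable set, so measurability can be checked for one fixed cluster at a time.
\<close>
abbreviation finite_sets :: "int set measure" where
  "finite_sets \<equiv> count_space (Collect finite)"

lemma measurable_walk_from: "(\<lambda>\<omega>. walk_from x \<omega> n) \<in> path_space \<rightarrow>\<^sub>M count_space UNIV"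
proof (induction n)
  case (Suc n)
  have "(\<lambda>\<omega>. i + \<omega> n) \<in> path_space \<rightarrow>\<^sub>M count_space UNIV" for i :: int
    by (rule measurable_compose[OF measurable_component_singleton, where g = "\<lambda>k. i + k"]) simp_all
  from measurable_compose_countable[of "\<lambda>i \<omega>. i + \<omega> n", OF this Suc] show ?case
    by (simp only: walk_from_def sum.lessThan_Suc add.assoc)
qed simp

lemma measurable_exit_time:
  "(\<lambda>\<omega>. exit_time (walk_from x \<omega>) C) \<in> path_space \<rightarrow>\<^sub>M count_space UNIV"
proof -
  note [measurable] = measurable_walk_from
  have "{\<omega> \<in> space path_space. exit_time (walk_from x \<omega>) C = t} \<in> sets path_space" for t
    by (cases t) (simp_all add: exit_time_eq_enat exit_time_eq_infinity)
  then show ?thesis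
    unfolding measurable_count_space_eq2_countable by (auto simp: vimage_def Int_def conj_commute)
qed

lemma measurable_exit_value [measurable]:
  "(\<lambda>\<omega>. exit_value f C (walk_from x \<omega>)) \<in> borel_measurable path_space"
  unfolding exit_value_def
proof (rule measurable_compose_countable[OF _ measurable_exit_time,
      where f = "\<lambda>t \<omega>. case t of enat n \<Rightarrow> f (walk_from x \<omega> n) | \<infinity> \<Rightarrow> 0"])
  fix t :: enat
  note [measurable] = measurable_walk_from
  show "(\<lambda>\<omega>. case t of enat n \<Rightarrow> f (walk_from x \<omega> n) | \<infinity> \<Rightarrow> 0) \<in> borel_measurable path_space"
    by (cases t) simp_all
qed

lemma measurable_settle:
  assumes "finite C"
  shows "(\<lambda>\<omega>. settle C (walk_from x \<omega>)) \<in> path_space \<rightarrow>\<^sub>M finite_sets"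
  unfolding settle_def
proof (rule measurable_compose_countable[OF _ measurable_exit_time,
      where f = "\<lambda>t \<omega>. case t of enat n \<Rightarrow> insert (walk_from x \<omega> n) C | \<infinity> \<Rightarrow> C"])
  fix t :: enat
  show "(\<lambda>\<omega>. case t of enat n \<Rightarrow> insert (walk_from x \<omega> n) C | \<infinity> \<Rightarrow> C) \<in> path_space \<rightarrow>\<^sub>M finite_sets"
  proof (cases t)
    case (enat n)
    have "(\<lambda>\<omega>. insert (walk_from x \<omega> n) C) \<in> path_space \<rightarrow>\<^sub>M finite_sets"
      by (rule measurable_compose[OF measurable_walk_from]) (use assms in auto)
    then show ?thesis using enat by simp
  qed (use assms in simp)
qed

text \<open>
  Clusters with an arbitrary initial set \<open>C\<close>, which allows recursion on the first walk as well as on the last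
  (\<open>grow_case_nat\<close>).
\<close>
primrec grow :: "int set \<Rightarrow> (nat \<Rightarrow> nat \<Rightarrow> int) \<Rightarrow> nat \<Rightarrow> int set" where
  "grow C \<Xi> 0 = C"
| "grow C \<Xi> (Suc m) = settle (grow C \<Xi> m) (walk_from 0 (\<Xi> m))"

lemma cluster_eq_grow: "cluster \<xi> m = grow {0} (\<lambda>k i. \<xi> (Suc k) (Suc i)) m"
proof (induction m)
  case (Suc m)
  show ?case unfolding cluster.simps grow.simps settle_def walk_eq_walk_from Suc ..
qed simp

lemma grow_case_nat: "grow C (case_nat \<omega> \<Xi>) (Suc m) = grow (settle C (walk_from 0 \<omega>)) \<Xi> m"
  by (induction m) simp_all

lemma finite_grow: "finite C \<Longrightarrow> finite (grow C \<Xi> m)"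
  by (induction m) (auto intro: finite_settle)

lemma card_grow_le: "finite C \<Longrightarrow> card (grow C \<Xi> m) \<le> card C + m"
proof (induction m)
  case (Suc m)
  then show ?case
    using card_settle_le[OF finite_grow[OF Suc.prems], of \<Xi> m "walk_from 0 (\<Xi> m)"] by simp
qed simp

lemma grow_mono: "m \<le> n \<Longrightarrow> grow C \<Xi> m \<subseteq> grow C \<Xi> n"
  by (rule lift_Suc_mono_le[of "grow C \<Xi>"]) (simp_all add: subset_settle)

lemma measurable_grow:
  assumes "finite C"
  shows "(\<lambda>\<Xi>. grow C \<Xi> m) \<in> (\<Pi>\<^sub>M k\<in>UNIV. path_space) \<rightarrow>\<^sub>M finite_sets"
proof (induction m)
  case (Suc m)
  have "(\<lambda>\<Xi>. settle (grow C \<Xi> m) (walk_from 0 (\<Xi> m))) \<in> (\<Pi>\<^sub>M k\<in>UNIV. path_space) \<rightarrow>\<^sub>M finite_sets"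
  proof (rule measurable_compose_countable'[OF _ Suc,
      where f = "\<lambda>B \<Xi>. settle B (walk_from 0 (\<Xi> m))"])
    fix B :: "int set" assume "B \<in> Collect finite"
    then show "(\<lambda>\<Xi>. settle B (walk_from 0 (\<Xi> m))) \<in> (\<Pi>\<^sub>M k\<in>UNIV. path_space) \<rightarrow>\<^sub>M finite_sets"
      by (intro measurable_compose[OF _ measurable_settle] measurable_component_singleton) auto
  qed (rule countable_Collect_finite)
  then show ?case by simp
qed (use assms in simp)

section \<open>Exponential moments of the cluster sum\<close>

text \<open>
  From \<open>exp (- t) \<le> 1 / (1 + t)\<close> and \<open>(1 - t + t\<^sup>2) (1 + t) = 1 + t\<^sup>3\<close>.
\<close>
lemma exp_minus_le_quadratic:
  fixes t :: real
  assumes "0 \<le> t"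
  shows "exp (- t) \<le> 1 - t + t\<^sup>2"
proof -
  have "1 \<le> (1 - t + t\<^sup>2) * (1 + t)"
    using assms by (simp add: algebra_simps power2_eq_square)
  also have "\<dots> \<le> (1 - t + t\<^sup>2) * exp t"
  proof (rule mult_left_mono)
    have "0 \<le> (1 - t)\<^sup>2" by simp
    then show "0 \<le> 1 - t + t\<^sup>2" using assms by (simp add: power2_eq_square algebra_simps)
  qed simp
  finally show ?thesis by (simp add: exp_minus field_simps)
qed

text \<open>
  An i.i.d. sequence is its first term followed by an independent copy of itself. This is the Markov property below, both for the
  increments of one walk and for the sequence of walks.
\<close>
lemma (in sequence_space) integral_first_step:
  fixes g :: "(nat \<Rightarrow> 'a) \<Rightarrow> real"
  assumes [measurable]: "g \<in> borel_measurable S" and bdd: "\<And>\<omega>. \<bar>g \<omega>\<bar> \<le> b"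
  shows "(\<integral>\<omega>. g \<omega> \<partial>S) = (\<integral>s. (\<integral>\<omega>. g (case_nat s \<omega>) \<partial>S) \<partial>M)"
proof -
  interpret MS: pair_prob_space M S ..
  have "(\<integral>\<omega>. g \<omega> \<partial>S) = (\<integral>\<omega>. g \<omega> \<partial>distr (M \<Otimes>\<^sub>M S) S (\<lambda>(s, \<omega>). case_nat s \<omega>))"
    by (simp add: PiM_iter)
  also have "\<dots> = (\<integral>p. g (case_nat (fst p) (snd p)) \<partial>(M \<Otimes>\<^sub>M S))"
    by (subst integral_distr) (simp_all add: split_beta)
  also have "\<dots> = (\<integral>s. (\<integral>\<omega>. g (case_nat s \<omega>) \<partial>S) \<partial>M)"
    by (subst MS.integral_fst'[symmetric])
      (auto intro!: MS.integrable_const_bound[of _ b] simp: bdd)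
  finally show ?thesis .
qed

lemma (in sequence_space) nn_integral_first_step:
  assumes [measurable]: "g \<in> borel_measurable S"
  shows "(\<integral>\<^sup>+\<omega>. g \<omega> \<partial>S) = (\<integral>\<^sup>+s. (\<integral>\<^sup>+\<omega>. g (case_nat s \<omega>) \<partial>S) \<partial>M)"
proof -
  have "(\<integral>\<^sup>+\<omega>. g \<omega> \<partial>S) = (\<integral>\<^sup>+\<omega>. g \<omega> \<partial>distr (M \<Otimes>\<^sub>M S) S (\<lambda>(s, \<omega>). case_nat s \<omega>))"
    by (simp add: PiM_iter)
  also have "\<dots> = (\<integral>\<^sup>+p. g (case_nat (fst p) (snd p)) \<partial>(M \<Otimes>\<^sub>M S))"
    by (subst nn_integral_distr) (simp_all add: split_beta)
  also have "\<dots> = (\<integral>\<^sup>+s. (\<integral>\<^sup>+\<omega>. g (case_nat s \<omega>) \<partial>S) \<partial>M)"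
    by (subst P.nn_integral_fst[symmetric]) simp_all
  finally show ?thesis .
qed

context increment_law
begin

definition path_law :: "(nat \<Rightarrow> int) measure" where
  "path_law = (\<Pi>\<^sub>M i\<in>UNIV. \<mu>)"

definition paths_law :: "(nat \<Rightarrow> nat \<Rightarrow> int) measure" where
  "paths_law = (\<Pi>\<^sub>M k\<in>UNIV. path_law)"

sublocale path: sequence_space \<mu>
  by unfold_locales

lemma sets_path_law [measurable_cong]: "sets path_law = sets path_space"
  unfolding path_law_def by (rule sets_PiM_cong) (simp_all add: sets_law)

lemma sets_paths_law [measurable_cong]: "sets paths_law = sets (\<Pi>\<^sub>M k\<in>UNIV. path_space)"
  unfolding paths_law_def by (rule sets_PiM_cong) (simp_all add: sets_path_law)

sublocale path_law: prob_space path_law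
  unfolding path_law_def by (rule prob_space_PiM) (rule prob_space_axioms)

sublocale paths: sequence_space path_law
  by unfold_locales

sublocale paths_law: prob_space paths_law
  unfolding paths_law_def by (rule prob_space_PiM) (rule path_law.prob_space_axioms)

lemma exit_value_bounds:
  assumes "\<And>x. 0 \<le> f x \<and> f x \<le> B"
  shows "0 \<le> exit_value f C S" "exit_value f C S \<le> B"
proof -
  have "0 \<le> B" using assms order_trans by blast
  then show "0 \<le> exit_value f C S" "exit_value f C S \<le> B"
    using assms by (auto simp: exit_value_def split: enat.splits)
qed

text \<open>
  Optional stopping for the settling place. The expected exit value \<open>e\<close> agrees with \<open>f\<close> off \<open>C\<close>
  and is harmonic on \<open>C\<close>, where \<open>f\<close> is subharmonic because \<open>z \<notin> C\<close>. So the minimum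
  principle applies to \<open>e - f\<close>.
\<close>
lemma expected_exit_value_ge:
  assumes "finite C" "z \<notin> C" and f: "\<And>x. 0 \<le> f x \<and> f x \<le> B"
    and sub: "\<And>x. x \<noteq> z \<Longrightarrow> f x \<le> step f x"
  shows "f x \<le> (\<integral>\<omega>. exit_value f C (walk_from x \<omega>) \<partial>path_law)"
proof -
  define e where "e x = (\<integral>\<omega>. exit_value f C (walk_from x \<omega>) \<partial>path_law)" for x
  have int: "integrable path_law (\<lambda>\<omega>. exit_value f C (walk_from x \<omega>))" for x
    by (rule path_law.integrable_const_bound[of _ B]) (auto simp: exit_value_bounds[of f B, OF f])
  have e: "0 \<le> e x" "e x \<le> B" for x
    unfolding e_def using exit_value_bounds[of f B, OF f] int
    by (auto intro!: path_law.integral_le_const)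
  have first: "e x = (\<integral>k. (if x \<in> C then e (x + k) else f x) \<partial>\<mu>)" for x
  proof -
    have "e x = (\<integral>k. (\<integral>\<omega>. exit_value f C (walk_from x (case_nat k \<omega>)) \<partial>path_law) \<partial>\<mu>)"
      unfolding e_def path_law_def
      by (rule path.integral_first_step[of _ B])
        (auto simp: exit_value_bounds[of f B, OF f] path_law_def[symmetric])
    then show ?thesis
      unfolding exit_value_first_step by (cases "x \<in> C") (simp_all add: e_def path_law.prob_space)
  qed
  have off: "e x = f x" if "x \<notin> C" for x
    using first[of x] that by (simp add: prob_space[simplified])
  have on: "e x = step e x" if "x \<in> C" for x
    using first[of x] that by (simp add: step_def)
  have "0 \<le> e x - f x"
  proof (rule minimum_principle[OF \<open>finite C\<close>, where D = "\<lambda>x. e x - f x"])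
    show "\<bar>e x - f x\<bar> \<le> B" for x using e[of x] f[of x] by (simp add: abs_le_iff)
    show "step (\<lambda>x. e x - f x) x \<le> e x - f x" if "x \<in> C" for x
    proof -
      have "step (\<lambda>x. e x - f x) x = step e x - step f x"
        unfolding step_def using e f
        by (intro Bochner_Integration.integral_diff integrable_bounded[of _ B]) auto
      moreover have "f x \<le> step f x" using that \<open>z \<notin> C\<close> by (intro sub) auto
      ultimately show ?thesis using on[OF that] by simp
    qed
  qed (simp add: off)
  then show ?thesis by (simp add: e_def)
qed

lemma exp_moment_exit_value:
  assumes "finite C" "z \<notin> C" and f: "\<And>x. 0 \<le> f x \<and> f x \<le> B"
    and sub: "\<And>x. x \<noteq> z \<Longrightarrow> f x \<le> step f x" and "0 \<le> \<theta>"
  shows "(\<integral>\<^sup>+\<omega>. ennreal (exp (- \<theta> * exit_value f C (walk_from x \<omega>))) \<partial>path_law)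
     \<le> ennreal (exp (\<theta>\<^sup>2 * B\<^sup>2 - \<theta> * f x))"
proof -
  let ?v = "\<lambda>\<omega>. exit_value f C (walk_from x \<omega>)"
  note v = exit_value_bounds[of f B, OF f]
  have int: "integrable path_law ?v"
    by (rule path_law.integrable_const_bound[of _ B]) (auto simp: v)
  have point: "exp (- \<theta> * ?v \<omega>) \<le> 1 - \<theta> * ?v \<omega> + \<theta>\<^sup>2 * B\<^sup>2" for \<omega>
  proof -
    have "exp (- (\<theta> * ?v \<omega>)) \<le> 1 - \<theta> * ?v \<omega> + (\<theta> * ?v \<omega>)\<^sup>2"
      using v \<open>0 \<le> \<theta>\<close> by (intro exp_minus_le_quadratic) simp
    also have "(\<theta> * ?v \<omega>)\<^sup>2 \<le> (\<theta> * B)\<^sup>2"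
      using v \<open>0 \<le> \<theta>\<close> by (intro power_mono mult_left_mono) auto
    finally show ?thesis by (simp add: power_mult_distrib)
  qed
  have "(\<integral>\<^sup>+\<omega>. ennreal (exp (- \<theta> * ?v \<omega>)) \<partial>path_law) \<le> (\<integral>\<^sup>+\<omega>. ennreal (1 - \<theta> * ?v \<omega> + \<theta>\<^sup>2 * B\<^sup>2) \<partial>path_law)"
    by (intro nn_integral_mono ennreal_leI point)
  also have "\<dots> = ennreal (\<integral>\<omega>. 1 - \<theta> * ?v \<omega> + \<theta>\<^sup>2 * B\<^sup>2 \<partial>path_law)"
    using int by (intro nn_integral_eq_integral AE_I2 order_trans[OF exp_ge_zero point]) auto
  also have "(\<integral>\<omega>. 1 - \<theta> * ?v \<omega> + \<theta>\<^sup>2 * B\<^sup>2 \<partial>path_law) = 1 - \<theta> * (\<integral>\<omega>. ?v \<omega> \<partial>path_law) + \<theta>\<^sup>2 * B\<^sup>2"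
    using int by (simp add: path_law.prob_space)
  also have "\<dots> \<le> 1 + (\<theta>\<^sup>2 * B\<^sup>2 - \<theta> * f x)"
    using mult_left_mono[OF expected_exit_value_ge[OF assms(1-4), of x] \<open>0 \<le> \<theta>\<close>] by simp
  also have "\<dots> \<le> exp (\<theta>\<^sup>2 * B\<^sup>2 - \<theta> * f x)" by (rule exp_ge_add_one_self)
  finally show ?thesis by (simp add: ennreal_leI)
qed

text \<open>
  The weight \<open>W\<close> is an exponential of the sum of \<open>f\<close> over the cluster and is switched off as soon as
  \<open>z\<close> is occupied. Each walk multiplies its mean by at most the factor of \<open>exp_moment_exit_value\<close>, whatever
  the cluster is when it starts.
\<close>
lemma exp_moment_grow:
  assumes "finite C" and f: "\<And>x. 0 \<le> f x \<and> f x \<le> B"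
    and sub: "\<And>x. x \<noteq> z \<Longrightarrow> f x \<le> step f x" and "0 \<le> \<theta>"
  defines "W \<equiv> \<lambda>C. ennreal (if z \<in> C then 0 else exp (- \<theta> * sum f C))"
  shows "(\<integral>\<^sup>+\<Xi>. W (grow C \<Xi> m) \<partial>paths_law) \<le> W C * ennreal (exp (\<theta>\<^sup>2 * B\<^sup>2 - \<theta> * f 0) ^ m)"
  using \<open>finite C\<close>
proof (induction m arbitrary: C)
  case 0
  then show ?case by (simp add: paths_law.emeasure_space_1)
next
  case (Suc m)
  let ?q = "exp (\<theta>\<^sup>2 * B\<^sup>2 - \<theta> * f 0)"
  have [measurable]: "(\<lambda>\<Xi>. W (grow C \<Xi> m)) \<in> borel_measurable (\<Pi>\<^sub>M k\<in>UNIV. path_space)" if "finite C" for C m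
    by (rule measurable_compose[OF measurable_grow[OF that]]) simp
  have one: "(\<integral>\<^sup>+\<omega>. W (settle C (walk_from 0 \<omega>)) \<partial>path_law) \<le> W C * ennreal ?q"
  proof (cases "z \<in> C")
    case True
    then have "W (settle C S) = 0" for S
      using subset_settle[of C S] by (auto simp: W_def)
    then show ?thesis by simp
  next
    case False
    have "W (settle C S) \<le> W C * ennreal (exp (- \<theta> * exit_value f C S))" for S
      using False by (auto simp: W_def sum_settle[OF Suc.prems] exp_add[symmetric] ennreal_mult[symmetric] algebra_simps)
    then have "(\<integral>\<^sup>+\<omega>. W (settle C (walk_from 0 \<omega>)) \<partial>path_law) \<le>
        (\<integral>\<^sup>+\<omega>. W C * ennreal (exp (- \<theta> * exit_value f C (walk_from 0 \<omega>))) \<partial>path_law)"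
      by (intro nn_integral_mono)
    also have "\<dots> = W C * (\<integral>\<^sup>+\<omega>. ennreal (exp (- \<theta> * exit_value f C (walk_from 0 \<omega>))) \<partial>path_law)"
      by (rule nn_integral_cmult) measurable
    also have "\<dots> \<le> W C * ennreal ?q"
      by (intro mult_left_mono exp_moment_exit_value[OF Suc.prems False f sub \<open>0 \<le> \<theta>\<close>]) auto
    finally show ?thesis .
  qed
  have "(\<integral>\<^sup>+\<Xi>. W (grow C \<Xi> (Suc m)) \<partial>paths_law) =
      (\<integral>\<^sup>+\<omega>. (\<integral>\<^sup>+\<Xi>. W (grow C (case_nat \<omega> \<Xi>) (Suc m)) \<partial>paths_law) \<partial>path_law)"
    unfolding paths_law_def
    by (rule paths.nn_integral_first_step) (use Suc.prems in \<open>simp add: paths_law_def[symmetric] del: grow.simps\<close>)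
  also have "\<dots> \<le> (\<integral>\<^sup>+\<omega>. W (settle C (walk_from 0 \<omega>)) * ennreal (?q ^ m) \<partial>path_law)"
    unfolding grow_case_nat by (intro nn_integral_mono Suc.IH finite_settle Suc.prems)
  also have "\<dots> = (\<integral>\<^sup>+\<omega>. W (settle C (walk_from 0 \<omega>)) \<partial>path_law) * ennreal (?q ^ m)"
  proof (rule nn_integral_multc)
    have "(\<lambda>\<omega>. W (settle C (walk_from 0 \<omega>))) \<in> borel_measurable path_space"
      by (rule measurable_compose[OF measurable_settle[OF Suc.prems]]) simp
    then show "(\<lambda>\<omega>. W (settle C (walk_from 0 \<omega>))) \<in> borel_measurable path_law" by simp
  qed
  also have "\<dots> \<le> (W C * ennreal ?q) * ennreal (?q ^ m)"
    by (intro mult_right_mono one) simp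
  also have "\<dots> = W C * ennreal (?q ^ Suc m)"
    by (simp add: ennreal_mult mult.assoc)
  finally show ?case .
qed

end

section \<open>The inner radius\<close>

lemma inner_radius_ge: "{- int r..int r} \<subseteq> cluster \<xi> m \<Longrightarrow> r \<le> inner_radius \<xi> m"
  unfolding inner_radius_def by (rule Max_ge[OF finite_inner_radius_set]) simp

lemma inner_radius_le: "2 * inner_radius \<xi> m \<le> m"
proof -
  let ?r = "inner_radius \<xi> m"
  have "?r \<in> {r. {- int r..int r} \<subseteq> cluster \<xi> m}"
    unfolding inner_radius_def by (rule Max_in[OF finite_inner_radius_set inner_radius_set_nonempty])
  then have "card {- int ?r..int ?r} \<le> card (cluster \<xi> m)"
    by (intro card_mono finite_cluster) simp
  also have "\<dots> \<le> card {0::int} + m"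
    unfolding cluster_eq_grow by (rule card_grow_le) simp
  finally show ?thesis by simp
qed

text \<open>
  The sites with \<open>\<bar>z\<bar> \<le> (1 - \<epsilon>) n\<close> are filled by \<open>2 n\<close> walks; for the other values of
  the index take \<open>n = m div 2\<close> and use that clusters increase.
\<close>
lemma inner_radius_limit:
  assumes "\<And>\<epsilon>. 0 < \<epsilon> \<Longrightarrow> \<epsilon> \<le> 1 \<Longrightarrow> eventually (\<lambda>n. \<forall>z. \<bar>real_of_int z\<bar> \<le> (1 - \<epsilon>) * real n
    \<longrightarrow> z \<in> cluster \<xi> (2 * n)) sequentially"
  shows "(\<lambda>m. real (inner_radius \<xi> m) / real m) \<longlonglongrightarrow> 1 / 2"
proof (rule LIMSEQ_I)
  fix e :: real assume "0 < e"
  define \<epsilon> where "\<epsilon> = min e 1"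
  have \<epsilon>: "0 < \<epsilon>" "\<epsilon> \<le> 1" "\<epsilon> \<le> e" using \<open>0 < e\<close> by (auto simp: \<epsilon>_def)
  obtain n0 where n0: "\<And>n z. n \<ge> n0 \<Longrightarrow> \<bar>real_of_int z\<bar> \<le> (1 - \<epsilon>) * real n \<Longrightarrow> z \<in> cluster \<xi> (2 * n)"
    using assms[OF \<epsilon>(1,2)] by (auto simp: eventually_sequentially)
  obtain m0 where m0: "3 / e < real m0" using reals_Archimedean2 by blast
  have "norm (real (inner_radius \<xi> m) / real m - 1 / 2) < e" if m: "m \<ge> 2 * n0 + m0 + 2" for m
  proof -
    define n where "n = m div 2"
    have n: "n \<ge> n0" "2 * n \<le> m" "real m - 1 \<le> 2 * real n"
      using m by (auto simp: n_def)
    have mpos: "0 < real m" using m by simp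
    define r where "r = nat \<lfloor>(1 - \<epsilon>) * real n\<rfloor>"
    have r0: "0 \<le> (1 - \<epsilon>) * real n" using \<epsilon> by simp
    then have r: "real r \<le> (1 - \<epsilon>) * real n" "(1 - \<epsilon>) * real n - 1 \<le> real r"
      unfolding r_def by linarith+
    have "{- int r..int r} \<subseteq> cluster \<xi> (2 * n)"
    proof
      fix z assume "z \<in> {- int r..int r}"
      then have "\<bar>real_of_int z\<bar> \<le> real r" by auto
      then show "z \<in> cluster \<xi> (2 * n)" using r n by (intro n0) auto
    qed
    also have "\<dots> \<subseteq> cluster \<xi> m"
      unfolding cluster_eq_grow by (rule grow_mono) (rule n)
    finally have "r \<le> inner_radius \<xi> m" by (rule inner_radius_ge)
    then have "(1 - \<epsilon>) * real n - 1 \<le> real (inner_radius \<xi> m)" using r by linarith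
    moreover have "\<epsilon> * real n \<le> e * (real m / 2)"
      using \<epsilon> n \<open>0 < e\<close> by (intro mult_mono) auto
    ultimately have lower: "real m / 2 - 3 / 2 - e * (real m / 2) \<le> real (inner_radius \<xi> m)"
      using n by (simp add: algebra_simps)
    have "3 < e * real m0" using m0 \<open>0 < e\<close> by (simp add: field_simps)
    also have "\<dots> \<le> e * real m" using m \<open>0 < e\<close> by simp
    finally have "real m / 2 - e * real m < real (inner_radius \<xi> m)" using lower by simp
    then have "1 / 2 - e < real (inner_radius \<xi> m) / real m"
      using mpos by (simp add: field_simps)
    moreover have "2 * real (inner_radius \<xi> m) \<le> real m"
      using inner_radius_le[of \<xi> m] by linarith
    then have "real (inner_radius \<xi> m) / real m \<le> 1 / 2" using mpos by (simp add: field_simps)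
    ultimately show ?thesis using \<open>0 < e\<close> by (simp add: abs_less_iff)
  qed
  then show "\<exists>m0. \<forall>m\<ge>m0. norm (real (inner_radius \<xi> m) / real m - 1 / 2) < e" by blast
qed

context increment_law
begin

lemma sets_miss [measurable]: "{\<Xi> \<in> space paths_law. z \<notin> grow {0} \<Xi> m} \<in> sets paths_law"
proof -
  have "(\<lambda>\<Xi>. grow {0} \<Xi> m) \<in> paths_law \<rightarrow>\<^sub>M finite_sets"
    using measurable_grow[of "{0}" m] by simp
  from measurable_sets[OF this, of "{C. finite C \<and> z \<notin> C}"] show ?thesis
    by (auto simp: vimage_def finite_grow Int_def conj_commute)
qed

text \<open>
  Markov's inequality for the weight of \<open>exp_moment_grow\<close>. On the event that \<open>z\<close> is missing,
  \<open>barrier\<close> bounds the sum of \<open>f\<close> over the cluster by \<open>2 n f(0) - c n\<close>, so the probability is at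
  most \<open>exp (2 n \<theta>\<^sup>2 B\<^sup>2 - \<theta> c n)\<close>, and \<open>\<theta> = c / (4 B\<^sup>2)\<close> is the
  optimal choice.
\<close>
lemma miss_probability:
  assumes "0 < \<epsilon>" "\<epsilon> \<le> 1"
  shows "\<exists>\<kappa> n0. 0 < \<kappa> \<and> (\<forall>n\<ge>n0. \<forall>z. \<bar>real_of_int z\<bar> \<le> (1 - \<epsilon>) * real n \<longrightarrow>
    measure paths_law {\<Xi> \<in> space paths_law. z \<notin> grow {0} \<Xi> (2 * n)} \<le> exp (- \<kappa> * real n))"
proof -
  obtain B c n0 where B: "0 < B" "0 < c" and bar: "\<forall>n\<ge>n0. \<forall>z. \<bar>real_of_int z\<bar> \<le> (1 - \<epsilon>) * real n \<longrightarrow>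
    (\<exists>f. (\<forall>x. 0 \<le> f x \<and> f x \<le> B) \<and> (\<forall>x. x \<noteq> z \<longrightarrow> f x \<le> step f x) \<and>
       (\<forall>C. finite C \<and> card C \<le> 2 * n + 1 \<longrightarrow> sum f C \<le> 2 * real n * f 0 - c * real n))"
    using barrier[OF assms] by (elim exE conjE) (rule that)
  define \<theta> where "\<theta> = c / (4 * B\<^sup>2)"
  define \<kappa> where "\<kappa> = c\<^sup>2 / (8 * B\<^sup>2)"
  have \<theta>: "0 < \<theta>" using B by (simp add: \<theta>_def)
  have opt: "\<theta> * c - 2 * \<theta>\<^sup>2 * B\<^sup>2 = \<kappa>"
    using B by (simp add: \<theta>_def \<kappa>_def field_simps power2_eq_square)
  have "measure paths_law {\<Xi> \<in> space paths_law. z \<notin> grow {0} \<Xi> (2 * n)} \<le> exp (- \<kappa> * real n)"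
    if n: "n \<ge> n0" and z: "\<bar>real_of_int z\<bar> \<le> (1 - \<epsilon>) * real n" for n z
  proof -
    obtain f where f: "\<And>x. 0 \<le> f x \<and> f x \<le> B" and sub: "\<And>x. x \<noteq> z \<Longrightarrow> f x \<le> step f x"
      and total: "\<And>C. finite C \<Longrightarrow> card C \<le> 2 * n + 1 \<Longrightarrow> sum f C \<le> 2 * real n * f 0 - c * real n"
      using bar[rule_format, OF n z] by blast
    define W where "W C = ennreal (if z \<in> C then 0 else exp (- \<theta> * sum f C))" for C
    let ?E = "{\<Xi> \<in> space paths_law. z \<notin> grow {0} \<Xi> (2 * n)}"
    let ?a = "exp (- \<theta> * (2 * real n * f 0 - c * real n))"
    let ?q = "exp (\<theta>\<^sup>2 * B\<^sup>2 - \<theta> * f 0)"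
    have "ennreal ?a * emeasure paths_law ?E = (\<integral>\<^sup>+\<Xi>. ennreal ?a * indicator ?E \<Xi> \<partial>paths_law)"
      by (subst nn_integral_cmult_indicator) simp_all
    also have "\<dots> \<le> (\<integral>\<^sup>+\<Xi>. W (grow {0} \<Xi> (2 * n)) \<partial>paths_law)"
    proof (rule nn_integral_mono)
      fix \<Xi>
      show "ennreal ?a * indicator ?E \<Xi> \<le> W (grow {0} \<Xi> (2 * n))"
      proof (cases "\<Xi> \<in> ?E")
        case True
        have "sum f (grow {0} \<Xi> (2 * n)) \<le> 2 * real n * f 0 - c * real n"
          using card_grow_le[of "{0}" \<Xi> "2 * n"] by (intro total finite_grow) auto
        then have "\<theta> * sum f (grow {0} \<Xi> (2 * n)) \<le> \<theta> * (2 * real n * f 0 - c * real n)"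
          using \<theta> by (intro mult_left_mono) auto
        then show ?thesis using True by (simp add: W_def)
      qed simp
    qed
    also have "\<dots> \<le> W {0} * ennreal (?q ^ (2 * n))"
      unfolding W_def using exp_moment_grow[of "{0}" f B z \<theta> "2 * n", OF _ f sub] \<theta> by simp
    also have "\<dots> \<le> 1 * ennreal (?q ^ (2 * n))"
      using f[of 0] \<theta> by (intro mult_right_mono) (auto simp: W_def)
    also have "?q ^ (2 * n) = exp (2 * real n * (\<theta>\<^sup>2 * B\<^sup>2 - \<theta> * f 0))"
      by (simp add: exp_of_nat_mult[symmetric])
    finally have "ennreal (?a * measure paths_law ?E) \<le> ennreal (exp (2 * real n * (\<theta>\<^sup>2 * B\<^sup>2 - \<theta> * f 0)))"
      by (simp add: paths_law.emeasure_eq_measure ennreal_mult)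
    then have "?a * measure paths_law ?E \<le> exp (2 * real n * (\<theta>\<^sup>2 * B\<^sup>2 - \<theta> * f 0))"
      by (simp add: ennreal_le_iff)
    then have "measure paths_law ?E \<le> exp (2 * real n * (\<theta>\<^sup>2 * B\<^sup>2 - \<theta> * f 0)) / ?a"
      by (simp add: pos_le_divide_eq mult.commute)
    also have "\<dots> = exp (- (\<theta> * c - 2 * \<theta>\<^sup>2 * B\<^sup>2) * real n)"
      unfolding exp_diff[symmetric] by (rule arg_cong[of _ _ exp]) (simp add: algebra_simps)
    finally show ?thesis unfolding opt .
  qed
  moreover have "0 < \<kappa>" using B by (simp add: \<kappa>_def)
  ultimately show ?thesis by blast
qed

lemma AE_eventually_filled:
  assumes "0 < \<epsilon>" "\<epsilon> \<le> 1"
  shows "AE \<Xi> in paths_law. eventually (\<lambda>n. \<forall>z. \<bar>real_of_int z\<bar> \<le> (1 - \<epsilon>) * real n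
    \<longrightarrow> z \<in> grow {0} \<Xi> (2 * n)) sequentially"
proof -
  obtain \<kappa> n0 where \<kappa>: "0 < \<kappa>" and miss: "\<And>n z. n \<ge> n0 \<Longrightarrow> \<bar>real_of_int z\<bar> \<le> (1 - \<epsilon>) * real n \<Longrightarrow>
    measure paths_law {\<Xi> \<in> space paths_law. z \<notin> grow {0} \<Xi> (2 * n)} \<le> exp (- \<kappa> * real n)"
    using miss_probability[OF assms] by blast
  define T where "T n = {z. \<bar>real_of_int z\<bar> \<le> (1 - \<epsilon>) * real n}" for n :: nat
  have T_sub: "T n \<subseteq> {- int n..int n}" for n
  proof
    fix z assume "z \<in> T n"
    moreover have "0 \<le> \<epsilon> * real n" using assms by simp
    ultimately have "\<bar>real_of_int z\<bar> \<le> real n" by (simp add: T_def algebra_simps)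
    then show "z \<in> {- int n..int n}" by simp linarith
  qed
  have finT: "finite (T n)" for n using T_sub by (rule finite_subset) simp
  have cardT: "real (card (T n)) \<le> 2 * real n + 1" for n
    using card_mono[OF _ T_sub[of n]] by simp
  define E where "E n = (\<Union>z\<in>T n. {\<Xi> \<in> space paths_law. z \<notin> grow {0} \<Xi> (2 * n)})" for n
  have E_meas: "E n \<in> sets paths_law" for n
    unfolding E_def using finT by (intro sets.finite_UN) auto
  have E_le: "measure paths_law (E n) \<le> (2 * real n + 1) * exp (- \<kappa> * real n)" if "n \<ge> n0" for n
  proof -
    have "measure paths_law (E n) \<le> (\<Sum>z\<in>T n. measure paths_law {\<Xi> \<in> space paths_law. z \<notin> grow {0} \<Xi> (2 * n)})"
      unfolding E_def using finT by (intro measure_UNION_le) auto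
    also have "\<dots> \<le> (\<Sum>z\<in>T n. exp (- \<kappa> * real n))"
      using that by (intro sum_mono miss) (auto simp: T_def)
    also have "\<dots> \<le> (2 * real n + 1) * exp (- \<kappa> * real n)"
      using cardT[of n] by (simp add: mult_right_mono)
    finally show ?thesis .
  qed
  have "norm (exp (- \<kappa>)) < 1" using \<kappa> by simp
  from summable_mult[OF sums_summable[OF geometric_deriv_sums[OF this]], of 2]
  have "summable (\<lambda>n. 2 * (real (Suc n) * exp (- \<kappa>) ^ n))" by simp
  then have "summable (\<lambda>n. measure paths_law (E n))"
  proof (rule summable_comparison_test')
    fix n assume "n \<ge> n0"
    then have "measure paths_law (E n) \<le> (2 * real n + 1) * exp (- \<kappa> * real n)" by (rule E_le)
    also have "\<dots> \<le> (2 * real (Suc n)) * exp (- \<kappa> * real n)" by (intro mult_right_mono) auto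
    also have "exp (- \<kappa> * real n) = exp (- \<kappa>) ^ n"
      by (simp add: exp_of_nat_mult[symmetric] mult.commute)
    finally show "norm (measure paths_law (E n)) \<le> 2 * (real (Suc n) * exp (- \<kappa>) ^ n)"
      by (simp only: mult.assoc real_norm_def abs_of_nonneg measure_nonneg)
  qed
  then have "AE \<Xi> in paths_law. eventually (\<lambda>n. \<Xi> \<in> space paths_law - E n) sequentially"
    by (intro borel_cantelli_AE1 E_meas) (auto simp: paths_law.emeasure_eq_measure)
  then show ?thesis
    by eventually_elim (auto elim!: eventually_mono simp: E_def T_def)
qed

text \<open>
  The exceptional null sets for \<open>\<epsilon> = 1 / (j + 1)\<close> are merged; a smaller \<open>\<epsilon>\<close> gives a
  stronger property.
\<close>

lemma AE_eventually_filled_all: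
  "AE \<Xi> in paths_law. \<forall>\<epsilon>. 0 < \<epsilon> \<longrightarrow> \<epsilon> \<le> 1 \<longrightarrow> eventually (\<lambda>n. \<forall>z. \<bar>real_of_int z\<bar> \<le> (1 - \<epsilon>) * real n
    \<longrightarrow> z \<in> grow {0} \<Xi> (2 * n)) sequentially"
proof -
  have "AE \<Xi> in paths_law. \<forall>j. eventually (\<lambda>n. \<forall>z. \<bar>real_of_int z\<bar> \<le> (1 - inverse (Suc j)) * real n
    \<longrightarrow> z \<in> grow {0} \<Xi> (2 * n)) sequentially"
    unfolding AE_all_countable by (intro allI AE_eventually_filled) (auto simp: inverse_eq_divide)
  then show ?thesis
  proof eventually_elim
    case (elim \<Xi>)
    show ?case
    proof (intro allI impI)
      fix \<epsilon> :: real assume "0 < \<epsilon>"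
      then obtain j where j: "inverse (Suc j) < \<epsilon>" using reals_Archimedean by blast
      show "eventually (\<lambda>n. \<forall>z. \<bar>real_of_int z\<bar> \<le> (1 - \<epsilon>) * real n \<longrightarrow> z \<in> grow {0} \<Xi> (2 * n)) sequentially"
        using elim[rule_format, of j]
      proof eventually_elim
        case (elim n)
        have "(1 - \<epsilon>) * real n \<le> (1 - inverse (Suc j)) * real n"
          using j by (intro mult_right_mono) auto
        then show ?case using elim by (meson order_trans)
      qed
    qed
  qed
qed

end

section \<open>The law of the array of increments\<close>

text \<open>
  Independence of the doubly indexed family gives, by grouping the index set into rows, independent walks; within a row it gives
  independent increments. Thus the whole array has the law of an i.i.d. sequence of i.i.d. sequences, numbered from \<open>0\<close>.
\<close>
lemma (in prob_space) distr_iid_paths: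
  fixes Xs :: "nat \<Rightarrow> nat \<Rightarrow> 'a \<Rightarrow> int"
  assumes indep: "indep_vars (\<lambda>_. count_space UNIV) (\<lambda>(m, i). Xs m i) ({1..} \<times> {1..})"
    and ident: "\<And>m i. m \<ge> 1 \<Longrightarrow> i \<ge> 1 \<Longrightarrow> distr M (count_space UNIV) (Xs m i) = \<mu>"
  shows "distr M (\<Pi>\<^sub>M k\<in>UNIV. path_space) (\<lambda>\<omega> k i. Xs (Suc k) (Suc i) \<omega>) =
    (\<Pi>\<^sub>M k\<in>(UNIV::nat set). \<Pi>\<^sub>M i\<in>(UNIV::nat set). \<mu>)"
proof -
  let ?X = "\<lambda>(m, i). Xs m i"
  have one: "distr M path_space (\<lambda>\<omega> i. Xs (Suc k) (Suc i) \<omega>) = (\<Pi>\<^sub>M i\<in>(UNIV::nat set). \<mu>)" for k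
  proof -
    have "indep_vars (\<lambda>i. PiM {(Suc k, Suc i)} (\<lambda>_. count_space UNIV))
        (\<lambda>i \<omega>. restrict (\<lambda>p. ?X p \<omega>) {(Suc k, Suc i)}) (UNIV :: nat set)"
      by (rule indep_vars_restrict[OF indep]) (auto simp: disjoint_family_on_def)
    from indep_vars_compose2[OF this, of "\<lambda>i p. p (Suc k, Suc i)" "\<lambda>_. count_space UNIV"]
    have ind: "indep_vars (\<lambda>_. count_space UNIV) (\<lambda>i. Xs (Suc k) (Suc i)) (UNIV :: nat set)"
      by (simp add: measurable_component_singleton)
    then have "random_variable (count_space UNIV) (Xs (Suc k) (Suc i))" for i
      unfolding indep_vars_def by blast
    with ind have "distr M path_space (\<lambda>\<omega>. \<lambda>i\<in>UNIV. Xs (Suc k) (Suc i) \<omega>) =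
        (\<Pi>\<^sub>M i\<in>UNIV. distr M (count_space UNIV) (Xs (Suc k) (Suc i)))"
      by (subst (asm) indep_vars_iff_distr_eq_PiM') auto
    then show ?thesis by (simp add: ident restrict_UNIV)
  qed
  have "indep_vars (\<lambda>k. PiM ({Suc k} \<times> {1..}) (\<lambda>_. count_space UNIV))
      (\<lambda>k \<omega>. restrict (\<lambda>p. ?X p \<omega>) ({Suc k} \<times> {1..})) (UNIV :: nat set)"
    by (rule indep_vars_restrict[OF indep]) (auto simp: disjoint_family_on_def)
  from indep_vars_compose2[OF this, of "\<lambda>k p i. p (Suc k, Suc i)" "\<lambda>_. path_space"]
  have ind: "indep_vars (\<lambda>_. path_space) (\<lambda>k \<omega> i. Xs (Suc k) (Suc i) \<omega>) (UNIV :: nat set)"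
    by (simp add: measurable_component_singleton measurable_abs_UNIV)
  then have "random_variable path_space (\<lambda>\<omega> i. Xs (Suc k) (Suc i) \<omega>)" for k
    unfolding indep_vars_def by blast
  with ind have "distr M (\<Pi>\<^sub>M k\<in>UNIV. path_space) (\<lambda>\<omega>. \<lambda>k\<in>UNIV. \<lambda>i. Xs (Suc k) (Suc i) \<omega>) =
      (\<Pi>\<^sub>M k\<in>UNIV. distr M path_space (\<lambda>\<omega> i. Xs (Suc k) (Suc i) \<omega>))"
    by (subst (asm) indep_vars_iff_distr_eq_PiM') auto
  then show ?thesis by (simp add: one restrict_UNIV)
qed

theorem theorem1p3:
  fixes N :: "'b measure" and X :: "'b \<Rightarrow> int"
    and M :: "'a measure" and Xs :: "nat \<Rightarrow> nat \<Rightarrow> 'a \<Rightarrow> int"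
  assumes "prob_space N"
    and "X \<in> N \<rightarrow>\<^sub>M count_space UNIV"
    and "prob_space M"
    and indep: "prob_space.indep_vars M (\<lambda>_. count_space UNIV) (\<lambda>(m, i). Xs m i) ({1..} \<times> {1..})"
    and ident: "\<And>m i. m \<ge> 1 \<Longrightarrow> i \<ge> 1 \<Longrightarrow>
          distr M (count_space UNIV) (Xs m i) = distr N (count_space UNIV) X"
    and irred: "irreducible_increment (distr N (count_space UNIV) X)"
    and second_moment: "integrable N (\<lambda>\<omega>. (real_of_int (X \<omega>))\<^sup>2)"
    and mean_zero: "prob_space.expectation N (\<lambda>\<omega>. real_of_int (X \<omega>)) = 0"
  shows "AE \<omega> in M.
           (\<lambda>m. real (inner_radius (\<lambda>k i. Xs k i \<omega>) m) / real m) \<longlonglongrightarrow> 1 / 2"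
proof -
  interpret M: prob_space M by fact
  define \<mu> where "\<mu> = distr N (count_space UNIV) X"
  have "prob_space \<mu>"
    unfolding \<mu>_def by (rule prob_space.prob_space_distr) fact+
  then interpret increment_law \<mu>
  proof (intro increment_law.intro increment_law_axioms.intro)
    show "sets \<mu> = UNIV" by (simp add: \<mu>_def)
    show "integrable \<mu> (\<lambda>k. (real_of_int k)\<^sup>2)"
      unfolding \<mu>_def using assms(2) second_moment by (subst integrable_distr_eq) simp_all
    show "(\<integral>k. real_of_int k \<partial>\<mu>) = 0"
      unfolding \<mu>_def using assms(2) mean_zero by (subst integral_distr) simp_all
    show "irreducible_increment \<mu>" using irred by (simp add: \<mu>_def)
  qed
  let ?\<Xi> = "\<lambda>\<omega> k i. Xs (Suc k) (Suc i) \<omega>"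
  have law: "distr M (\<Pi>\<^sub>M k\<in>UNIV. path_space) ?\<Xi> = paths_law"
    unfolding paths_law_def path_law_def
    by (rule M.distr_iid_paths[OF indep]) (simp add: ident \<mu>_def)
  have coord: "Xs m i \<in> M \<rightarrow>\<^sub>M count_space UNIV" if "m \<ge> 1" "i \<ge> 1" for m i
    using indep that unfolding M.indep_vars_def by fastforce
  have "?\<Xi> \<in> M \<rightarrow>\<^sub>M (\<Pi>\<^sub>M k\<in>UNIV. path_space)"
    by (intro measurable_abs_UNIV coord) auto
  from AE_distrD[OF this, unfolded law, OF AE_eventually_filled_all] show ?thesis
  proof eventually_elim
    case (elim \<omega>)
    then show ?case
      by (intro inner_radius_limit) (simp add: cluster_eq_grow)
  qed
qed

end
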